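(* Let $d\ge 1$ and let $k$ be a positive integer with $k\le 2d$. Consider the constrained-degree percolation model on $\mathbb{L}^d$ with constraint $k$. Let $A\subset\{0,1\}^{\mathcal{E}^d}$ be a local event. Then the function $t\mapsto\mathbb{P}_t(A)=\mathbb{P}(\omega_t^{-1}(A))$ is differentiable on $(0,1)$.
   Context: $\mathbb{L}^d=(\mathbb{Z}^d,\mathcal{E}^d)$ is the hypercubic lattice with nearest-neighbor edge set $\mathcal{E}^d$. Constrained-degree percolation (CDP) with constraint $k$: let $U=(U_e)_{e\in\mathcal{E}^d}$ (the collection of clocks) be i.i.d. random variables, uniform on $[0,1]$, and let $\mathbb{P}$ be the corresponding product probability measure on $[0,1]^{\mathcal{E}^d}$. At time $0$ all edges are closed. An edge $e=\langle u,v\rangle$ opens at time $U_e$ if, for all $s<U_e$, $$\max\{|\{x\in\mathbb{Z}^d:\langle x,u\rangle\text{ is open at time }s\}|,\ |\{x\in\mathbb{Z}^d:\langle x,v\rangle\text{ is open at time }s\}|\}<k;$$ otherwise it never opens. Once open, an edge remains open. For almost every $U$ this determines the state of every edge at every time. $\omega_t(U)\in\{0,1\}^{\mathcal{E}^d}$ is the configuration at time $t\in[0,1]$: $\omega_t(U,e)=1$ if $e$ is open at time $t$ and $\omega_t(U,e)=0$ if it is closed; $\omega_t^{-1}(A)=\{U:\omega_t(U)\in A\}$. An event $A\subset\{0,1\}^{\mathcal{E}^d}$ lives on a set $K\subset\mathcal{E}^d$ if whenever $\omega\in A$ and $\omega'(e)=\omega(e)$ for all $e\in K$, then $\omega'\in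 A$. $A$ is a local event if it lives on some finite set $K\subset\mathcal{E}^d$. *)

theory Defs
  imports "HOL-Probability.Probability"
begin

type_synonym 'd edge = "(int ^ 'd) set"

definition lattice_edges :: "('d::finite) edge set" where
  "lattice_edges = {{u, v} | u v. (\<Sum>i\<in>UNIV. \<bar>u $ i - v $ i\<bar>) = 1}"

definition clock_measure :: "(('d::finite) edge \<Rightarrow> real) measure" where
  "clock_measure = (\<Pi>\<^sub>M e\<in>lattice_edges. restrict_space lborel {0..1})"

lemma prob_space_clock_measure: "prob_space clock_measure"
  unfolding clock_measure_def
  by (intro prob_space_PiM prob_space_restrict_space) auto

lemma space_clock_measure: "space clock_measure = (lattice_edges \<rightarrow>\<^sub>E {0..1})"
  by (simp add: clock_measure_def space_PiM space_restrict_space)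

definition configurations :: "(('d::finite) edge \<Rightarrow> nat) set" where
  "configurations = (lattice_edges \<rightarrow>\<^sub>E {0, 1})"

definition open_degree :: "(('d::finite) edge \<Rightarrow> nat) \<Rightarrow> int ^ 'd \<Rightarrow> nat" where
  "open_degree \<eta> u = card {x. {x, u} \<in> lattice_edges \<and> \<eta> {x, u} = 1}"

text \<open>
  The third clause says that \<open>e\<close> opens at time \<open>U e\<close> if neither endpoint has reached degree \<open>k\<close>
  strictly before, stays open from then on, and otherwise never opens. It is imposed for every
  real \<open>t\<close>, not just \<open>t \<in> [0, 1]\<close>; as the clocks take values in \<open>[0, 1]\<close>, this only
  fixes the otherwise arbitrary values of \<open>\<omega>\<close> at other times (all edges closed before time 0,
  the time 1 configuration after time 1), so that \<open>\<omega>\<close> can be unique as a function on the reals.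
\<close>

definition cdp_evolution ::
  "nat \<Rightarrow> (('d::finite) edge \<Rightarrow> real) \<Rightarrow> (real \<Rightarrow> 'd edge \<Rightarrow> nat) \<Rightarrow> bool" where
  "cdp_evolution k U \<omega> \<longleftrightarrow>
     (\<forall>t. \<omega> t \<in> configurations) \<and>
     (\<forall>e\<in>lattice_edges. \<omega> 0 e = 0) \<and>
     (\<forall>t. \<forall>e\<in>lattice_edges. \<omega> t e = 1 \<longleftrightarrow>
        U e \<le> t \<and>
        (\<forall>s u v. 0 \<le> s \<and> s < U e \<and> e = {u, v} \<longrightarrow>
           max (open_degree (\<omega> s) u) (open_degree (\<omega> s) v) < k))"

text \<open>
  The evolution exists and is unique only for almost every \<open>U\<close>; on the exceptional null set the
  value below is arbitrary. Preimages are therefore measured in the completion.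
\<close>

definition cdp :: "nat \<Rightarrow> real \<Rightarrow> (('d::finite) edge \<Rightarrow> real) \<Rightarrow> 'd edge \<Rightarrow> nat" where
  "cdp k t U = (THE \<omega>. cdp_evolution k U \<omega>) t"

definition cdp_prob :: "nat \<Rightarrow> (('d::finite) edge \<Rightarrow> nat) set \<Rightarrow> real \<Rightarrow> real" where
  "cdp_prob k A t = measure (completion clock_measure) (cdp k t -` A \<inter> space clock_measure)"

definition lives_on :: "(('d::finite) edge \<Rightarrow> nat) set \<Rightarrow> 'd edge set \<Rightarrow> bool" where
  "lives_on A K \<longleftrightarrow>
     (\<forall>\<eta>\<in>A. \<forall>\<eta>'\<in>configurations. (\<forall>e\<in>K. \<eta>' e = \<eta> e) \<longrightarrow> \<eta>' \<in> A)"

definition local_event :: "(('d::finite) edge \<Rightarrow> nat) set \<Rightarrow> bool" where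
  "local_event A \<longleftrightarrow>
     A \<subseteq> configurations \<and> (\<exists>K. finite K \<and> K \<subseteq> lattice_edges \<and> lives_on A K)"

end

theory Submission
  imports Defs
begin

text \<open>
  Whether an edge \<open>e\<close> opens is decided by the edges that can be reached from \<open>e\<close> along paths with
  decreasing clocks. There are at most \<open>D ^ n\<close> paths with \<open>n\<close> steps from \<open>e\<close>, and each is
  decreasing with probability at most \<open>1 / (n + 1)!\<close>. So almost surely no infinite
  decreasing path exists, which makes the evolution exist uniquely, and the approximation \<open>P n t\<close>
  of the probability of the event that follows decreasing paths for \<open>n\<close> steps only
  satisfies \<open>\<bar>P (n + 1) t - P n t\<bar> \<le> C D ^ n / (n + 1)!\<close>.

  This difference is the expectation of a function of \<open>N\<close> clocks, \<open>N\<close> growing exponentially in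
  \<open>n\<close>, that depends only on the order of the clocks and on which of them have rung at time \<open>t\<close>.
  It is therefore a combination of the weights \<open>t ^ j (1 - t) ^ (N - j)\<close>, whose logarithmic
  derivatives are at most \<open>N / min t (1 - t)\<close>. Hence the derivatives are summable as well,
  locally uniformly on the open unit interval.
\<close>

section \<open>Independent uniform clocks\<close>

abbreviation unit_interval :: "real measure" where
  "unit_interval \<equiv> restrict_space lborel {0..1}"

abbreviation clocks :: "'i set \<Rightarrow> ('i \<Rightarrow> real) measure" where
  "clocks I \<equiv> \<Pi>\<^sub>M i\<in>I. unit_interval"

lemma prob_space_unit_interval: "prob_space unit_interval"
  by (rule prob_space_restrict_space) auto

lemma space_unit_interval [simp]: "space unit_interval = {0..1}"
  by (simp add: space_restrict_space)

lemma prob_space_clocks: "prob_space (clocks I)"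
  by (intro prob_space_PiM prob_space_unit_interval)

lemma unit_interval_borel [measurable]: "(\<lambda>x. x) \<in> borel_measurable unit_interval"
  by (rule measurable_restrict_space1) simp

lemma measurable_clock [measurable (raw)]:
  "i \<in> I \<Longrightarrow> (\<lambda>U. U i) \<in> borel_measurable (clocks I)"
  by (rule measurable_compose[where g = "\<lambda>x. x", OF _ unit_interval_borel])
     (rule measurable_component_singleton)

text \<open>
  All orderings of the \<open>m\<close> clocks along \<open>xs\<close> are equally likely and mutually exclusive,
  so \<open>m!\<close> times the probability is at most 1. Ties need no separate treatment.
\<close>

lemma prob_decreasing_le:
  assumes xs: "set xs \<subseteq> I"
  shows "measure (clocks I) {U \<in> space (clocks I). sorted_wrt (\<lambda>i j. U j < U i) xs}
           \<le> 1 / fact (length xs)"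
proof (cases "distinct xs")
  case False
  have "\<not> sorted_wrt (\<lambda>i j. U j < U i) xs" for U :: "'a \<Rightarrow> real"
    using False by (metis distinct_conv_nth nat_neq_iff order.irrefl sorted_wrt_nth_less)
  then show ?thesis by simp
next
  case True
  define m where "m = length xs"
  interpret prob_space "clocks I" by (rule prob_space_clocks)
  \<comment> \<open>The reference event that \<open>m\<close> clocks decrease in the order of their
    indices. Each \<open>D ys\<close> is its preimage under the relabelling \<open>f\<close>, which
    preserves the product measure because \<open>ys\<close> is distinct, so all the
    \<open>D ys\<close> have equal probability.\<close>
  define L where "L = {V \<in> space (clocks {..<m}). \<forall>j\<in>{..<m}. \<forall>i\<in>{..<j}. V j < V i}"
  have L: "L \<in> sets (clocks {..<m})"
    unfolding L_def by measurable
  define D where "D ys = {U \<in> space (clocks I). sorted_wrt (\<lambda>i j. U j < U i) ys}" for ys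
  define P where "P = permutations_of_set (set xs)"
  have P: "finite P" "card P = fact m" "xs \<in> P"
    using True by (simp_all add: P_def m_def distinct_card permutations_of_setI)
  have D: "D ys \<in> events \<and> prob (D ys) = measure (clocks {..<m}) L" if "ys \<in> P" for ys
  proof -
    have ys: "set ys = set xs" "distinct ys" "length ys = m"
      using that True unfolding P_def m_def
      by (auto dest: permutations_of_setD simp: length_finite_permutations_of_set distinct_card)
    define f where "f U = (\<lambda>i\<in>{..<m}. U (ys ! i))" for U :: "'a \<Rightarrow> real"
    have nth: "ys ! i \<in> I" if "i < m" for i
      using ys xs that by (metis nth_mem subsetD)
    have f: "f \<in> clocks I \<rightarrow>\<^sub>M clocks {..<m}"
      unfolding f_def using nth by (intro measurable_restrict measurable_component_singleton) auto
    have "clocks {..<m} = distr (clocks I) (clocks {..<m}) f"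
      unfolding f_def
      by (rule distr_PiM_reindex[symmetric])
         (use ys nth in \<open>auto simp: inj_on_def nth_eq_iff_index_eq prob_space_unit_interval\<close>)
    then have "measure (clocks {..<m}) L = prob (f -` L \<inter> space (clocks I))"
      by (metis L f measure_distr)
    moreover have "f -` L \<inter> space (clocks I) = D ys"
      using measurable_space[OF f] ys(3)
      by (auto simp: D_def L_def f_def sorted_wrt_iff_nth_less)
    ultimately show ?thesis
      using measurable_sets[OF f L] by simp
  qed
  have disj: "disjoint_family_on D P"
  proof (unfold disjoint_family_on_def, intro ballI impI)
    fix ys zs assume *: "ys \<in> P" "zs \<in> P" "ys \<noteq> zs"
    have "ys = zs" if "U \<in> D ys \<inter> D zs" for U
    proof -
      have s: "sorted_wrt (\<lambda>i j. U j < U i) ys" "sorted_wrt (\<lambda>i j. U j < U i) zs"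
        using that by (auto simp: D_def)
      \<comment> \<open>Negated clocks turn both orderings into strictly increasing lists with the
        same set of values, so the value lists coincide. The values are injective on the indices,
        which carries the equality back to \<open>ys\<close> and \<open>zs\<close>.\<close>
      have "sorted_wrt (<) (map (\<lambda>i. - U i) ys)" "sorted_wrt (<) (map (\<lambda>i. - U i) zs)"
        using s by (simp_all add: sorted_wrt_map)
      moreover have set: "set ys = set zs"
        using * by (auto simp: P_def dest: permutations_of_setD)
      ultimately have eq: "map (\<lambda>i. - U i) ys = map (\<lambda>i. - U i) zs"
        by (metis list.set_map strict_sorted_equal)
      have "distinct (map (\<lambda>i. - U i) ys)"
        using \<open>sorted_wrt (<) (map (\<lambda>i. - U i) ys)\<close> strict_sorted_iff by blast
      then have "inj_on (\<lambda>i. - U i) (set ys \<union> set zs)"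
        using set by (simp add: distinct_map)
      then show ?thesis using eq by (metis map_inj_on)
    qed
    then show "D ys \<inter> D zs = {}" using * by blast
  qed
  have "fact m * prob (D xs) = (\<Sum>ys\<in>P. prob (D ys))"
    using D P by simp
  also have "\<dots> = prob (\<Union>ys\<in>P. D ys)"
    using D P disj by (intro finite_measure_finite_Union[symmetric]) auto
  also have "\<dots> \<le> 1" by simp
  finally show ?thesis
    by (simp add: D_def m_def field_simps)
qed

section \<open>A piecewise affine change of clocks\<close>

text \<open>
  The increasing bijection of the unit interval that is affine on \<open>[0, t]\<close> and on \<open>[t, 1]\<close>
  and maps \<open>t\<close> to \<open>s\<close>. It preserves the order of the clocks and the set of clocks that have rung.
\<close>

definition warp :: "real \<Rightarrow> real \<Rightarrow> real \<Rightarrow> real" where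
  "warp t s v = (if v \<le> t then s / t * v else 1 - (1 - s) / (1 - t) * (1 - v))"

text \<open>The Jacobian factor of \<open>warp t s\<close>, with the left-hand slope at the
  kink.\<close>

definition warp_slope :: "real \<Rightarrow> real \<Rightarrow> real \<Rightarrow> real" where
  "warp_slope t s v = (if v \<le> t then s / t else (1 - s) / (1 - t))"

lemma warp_measurable [measurable]:
  "warp t s \<in> borel_measurable borel" "warp_slope t s \<in> borel_measurable borel"
  unfolding warp_def warp_slope_def by measurable

context
  fixes t s :: real
  assumes t: "0 < t" "t < 1" and s: "0 < s" "s < 1"
begin

lemma warp_slope_nonneg: "0 \<le> warp_slope t s v"
  using t s by (simp add: warp_slope_def)

lemma warp_self: "warp t s t = s"
  using t by (simp add: warp_def)

lemma strict_mono_warp: "strict_mono (warp t s)"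
proof (rule strict_monoI)
  fix x y :: real assume "x < y"
  consider "y \<le> t" | "x \<le> t" "t < y" | "t < x" using \<open>x < y\<close> by linarith
  then show "warp t s x < warp t s y"
  proof cases
    case 2
    have "s / t * x \<le> s / t * t" using 2 t s by (intro mult_left_mono) auto
    moreover have "(1 - s) / (1 - t) * (1 - y) < (1 - s) / (1 - t) * (1 - t)"
      using 2 t s by (intro mult_strict_left_mono) auto
    ultimately show ?thesis using 2 t s by (simp add: warp_def)
  qed (use \<open>x < y\<close> t s in \<open>auto simp: warp_def divide_strict_right_mono mult_strict_left_mono\<close>)
qed

lemma warp_unit: "warp t s v \<in> {0..1} \<longleftrightarrow> v \<in> {0..1}"
proof -
  have "warp t s 0 = 0" "warp t s 1 = 1" using t by (simp_all add: warp_def)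
  then show ?thesis
    using strict_mono_less_eq[OF strict_mono_warp, of 0 v]
      strict_mono_less_eq[OF strict_mono_warp, of v 1] by simp
qed

text \<open>One-dimensional change of variables, carried out separately on the two affine pieces.
  The target interval is cut into \<open>{0..s}\<close> and \<open>{s<..1}\<close>, the images of
  \<open>{0..t}\<close> and \<open>{t<..1}\<close>.\<close>

lemma nn_integral_warp:
  assumes A: "A \<in> sets borel"
  shows "(\<integral>\<^sup>+ v. indicator A (warp t s v) * ennreal (warp_slope t s v) \<partial>unit_interval)
           = (\<integral>\<^sup>+ v. indicator A v \<partial>unit_interval)"
proof -
  note [measurable] = A
  have "(\<integral>\<^sup>+ v. indicator A v \<partial>unit_interval)
      = (\<integral>\<^sup>+ v. indicator A v * indicator {0..s} v + indicator A v * indicator {s<..1} v \<partial>lborel)"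
    using s by (auto simp: nn_integral_restrict_space indicator_def intro!: nn_integral_cong)
  also have "\<dots> = (\<integral>\<^sup>+ v. indicator A v * indicator {0..s} v \<partial>lborel)
                 + (\<integral>\<^sup>+ v. indicator A v * indicator {s<..1} v \<partial>lborel)"
    by (rule nn_integral_add) auto
  also have "(\<integral>\<^sup>+ v. indicator A v * indicator {0..s} v \<partial>lborel)
     = (\<integral>\<^sup>+ v. ennreal (s / t) * (indicator A (s / t * v) * indicator {0..s} (s / t * v)) \<partial>lborel)"
    using t s by (subst nn_integral_real_affine[where c = "s / t" and t = 0])
      (auto simp: nn_integral_cmult)
  also have "\<dots> = (\<integral>\<^sup>+ v. indicator A (warp t s v) * ennreal (warp_slope t s v) * indicator {0..t} v \<partial>lborel)"
    using t s by (intro nn_integral_cong)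
      (auto simp: warp_def warp_slope_def indicator_def field_simps zero_le_mult_iff)
  \<comment> \<open>The upper branch of \<open>warp\<close> is rewritten as intercept plus slope
    times \<open>v\<close>, the form required by the affine substitution rule.\<close>
  also have "(\<integral>\<^sup>+ v. indicator A v * indicator {s<..1} v \<partial>lborel)
     = (\<integral>\<^sup>+ v. ennreal ((1 - s) / (1 - t)) *
          (indicator A (1 - (1 - s) / (1 - t) + (1 - s) / (1 - t) * v)
           * indicator {s<..1} (1 - (1 - s) / (1 - t) + (1 - s) / (1 - t) * v)) \<partial>lborel)"
    using t s by (subst nn_integral_real_affine[where c = "(1 - s) / (1 - t)" and t = "1 - (1 - s) / (1 - t)"])
      (auto simp: nn_integral_cmult)
  also have "\<dots> = (\<integral>\<^sup>+ v. indicator A (warp t s v) * ennreal (warp_slope t s v) * indicator {t<..1} v \<partial>lborel)"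
  proof (intro nn_integral_cong)
    fix v :: real
    have "1 - c + c * v = 1 - c * (1 - v)" for c :: real
      by (simp add: algebra_simps)
    note * = this[of "(1 - s) / (1 - t)"]
    have "1 - (1 - s) / (1 - t) * (1 - v) \<in> {s<..1} \<longleftrightarrow> v \<in> {t<..1}"
    proof -
      have "s < 1 - (1 - s) / (1 - t) * (1 - v) \<longleftrightarrow> t < v"
      proof -
        have "s < 1 - (1 - s) / (1 - t) * (1 - v) \<longleftrightarrow> (1 - s) * (1 - v) / (1 - t) < 1 - s"
          by (simp add: algebra_simps)
        also have "\<dots> \<longleftrightarrow> (1 - s) * (1 - v) < (1 - s) * (1 - t)"
          using t by (simp add: divide_less_eq)
        also have "\<dots> \<longleftrightarrow> t < v"
          using s by (subst mult_less_cancel_left_pos) auto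
        finally show ?thesis .
      qed
      moreover have "1 - (1 - s) / (1 - t) * (1 - v) \<le> 1 \<longleftrightarrow> v \<le> 1"
        using t s by (auto simp: zero_le_mult_iff zero_le_divide_iff)
      ultimately show ?thesis by simp
    qed
    then show "ennreal ((1 - s) / (1 - t)) *
          (indicator A (1 - (1 - s) / (1 - t) + (1 - s) / (1 - t) * v)
           * indicator {s<..1} (1 - (1 - s) / (1 - t) + (1 - s) / (1 - t) * v))
        = indicator A (warp t s v) * ennreal (warp_slope t s v) * indicator {t<..1} v"
      unfolding * by (auto simp: warp_def warp_slope_def indicator_def)
  qed
  also have "(\<integral>\<^sup>+ v. indicator A (warp t s v) * ennreal (warp_slope t s v) * indicator {0..t} v \<partial>lborel) + \<dots>
     = (\<integral>\<^sup>+ v. indicator A (warp t s v) * ennreal (warp_slope t s v) * indicator {0..t} v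
          + indicator A (warp t s v) * ennreal (warp_slope t s v) * indicator {t<..1} v \<partial>lborel)"
    by (rule nn_integral_add[symmetric]) auto
  also have "\<dots> = (\<integral>\<^sup>+ v. indicator A (warp t s v) * ennreal (warp_slope t s v) \<partial>unit_interval)"
    using t by (auto simp: nn_integral_restrict_space indicator_def intro!: nn_integral_cong)
  finally show ?thesis ..
qed

text \<open>A measure on the finite product is determined by boxes, and on a box the weighted
  integral factorises into the one-dimensional changes of variables.\<close>

lemma distr_clocks_warp:
  assumes B: "finite B"
  shows "distr (density (clocks B) (\<lambda>V. \<Prod>i\<in>B. ennreal (warp_slope t s (V i)))) (clocks B)
           (\<lambda>V. \<lambda>i\<in>B. warp t s (V i)) = clocks B" (is "distr ?N _ ?f = _")
proof -
  interpret product_sigma_finite "\<lambda>_. unit_interval"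
    by (simp add: product_sigma_finite_def prob_space_imp_sigma_finite prob_space_unit_interval)
  have w: "warp t s \<in> unit_interval \<rightarrow>\<^sub>M unit_interval"
    by (rule measurable_restrict_space2) (use warp_unit in auto)
  have f: "?f \<in> clocks B \<rightarrow>\<^sub>M clocks B"
    by (intro measurable_restrict measurable_compose[where g = "warp t s", OF _ w]
          measurable_component_singleton)
  then have f': "?f \<in> ?N \<rightarrow>\<^sub>M clocks B" by simp
  show ?thesis
  proof (rule PiM_eqI[OF B])
    fix A assume A: "\<And>i. i \<in> B \<Longrightarrow> A i \<in> sets unit_interval"
    have A': "A i \<in> sets borel" "A i \<subseteq> {0..1}" if "i \<in> B" for i
      using A[OF that] by (auto simp: sets_restrict_space)
    have PA: "Pi\<^sub>E B A \<in> sets (clocks B)"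
      using A B by (intro sets_PiM_I_finite) auto
    have "emeasure (distr ?N (clocks B) ?f) (Pi\<^sub>E B A)
        = (\<integral>\<^sup>+ V. (\<Prod>i\<in>B. ennreal (warp_slope t s (V i))) * indicator (?f -` Pi\<^sub>E B A \<inter> space ?N) V \<partial>clocks B)"
      using measurable_sets[OF f PA]
      by (subst emeasure_distr[OF f' PA], subst emeasure_density) auto
    also have "\<dots> = (\<integral>\<^sup>+ V. (\<Prod>i\<in>B. indicator (A i) (warp t s (V i)) * ennreal (warp_slope t s (V i))) \<partial>clocks B)"
    proof (rule nn_integral_cong)
      fix V assume V: "V \<in> space (clocks B)"
      have "indicator (?f -` Pi\<^sub>E B A \<inter> space ?N) V = (\<Prod>i\<in>B. indicator (A i) (warp t s (V i)) :: ennreal)"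
        using V B by (auto simp: indicator_def PiE_iff prod.neutral)
      then show "(\<Prod>i\<in>B. ennreal (warp_slope t s (V i))) * indicator (?f -` Pi\<^sub>E B A \<inter> space ?N) V
          = (\<Prod>i\<in>B. indicator (A i) (warp t s (V i)) * ennreal (warp_slope t s (V i)))"
        by (simp add: prod.distrib mult.commute)
    qed
    also have "\<dots> = (\<Prod>i\<in>B. \<integral>\<^sup>+ v. indicator (A i) (warp t s v) * ennreal (warp_slope t s v) \<partial>unit_interval)"
    proof (rule product_nn_integral_prod[OF B])
      fix i assume "i \<in> B"
      have m: "(\<lambda>v. indicator X (warp t s v) * ennreal (warp_slope t s v)) \<in> borel_measurable borel"
        if [measurable]: "X \<in> sets borel" for X
        by measurable
      show "(\<lambda>v. indicator (A i) (warp t s v) * ennreal (warp_slope t s v)) \<in> borel_measurable unit_interval"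
        by (rule measurable_restrict_space1) (simp add: m A'(1)[OF \<open>i \<in> B\<close>])
    qed
    also have "\<dots> = (\<Prod>i\<in>B. emeasure unit_interval (A i))"
      using A A' by (intro prod.cong refl) (simp add: nn_integral_warp)
    finally show "emeasure (distr ?N (clocks B) ?f) (Pi\<^sub>E B A) = (\<Prod>i\<in>B. emeasure unit_interval (A i))" .
  qed simp
qed

text \<open>Every factor is one of two slopes, so the Jacobian depends on \<open>V\<close> only
  through the number of clocks that have rung by time \<open>t\<close>. This is what turns
  expectations into polynomials in \<open>s\<close>.\<close>

lemma prod_warp_slope:
  assumes "finite B"
  shows "(\<Prod>i\<in>B. warp_slope t s (V i)) =
    (s / t) ^ card {i \<in> B. V i \<le> t} * ((1 - s) / (1 - t)) ^ (card B - card {i \<in> B. V i \<le> t})"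
proof -
  have "(\<Prod>i\<in>B. warp_slope t s (V i))
      = (\<Prod>i\<in>{i \<in> B. V i \<le> t}. warp_slope t s (V i)) * (\<Prod>i\<in>B - {i \<in> B. V i \<le> t}. warp_slope t s (V i))"
    using assms by (subst prod.subset_diff[of "{i \<in> B. V i \<le> t}"]) (auto simp: mult.commute)
  also have "(\<Prod>i\<in>{i \<in> B. V i \<le> t}. warp_slope t s (V i)) = (s / t) ^ card {i \<in> B. V i \<le> t}"
    by (simp add: warp_slope_def)
  also have "(\<Prod>i\<in>B - {i \<in> B. V i \<le> t}. warp_slope t s (V i))
      = (\<Prod>i\<in>B - {i \<in> B. V i \<le> t}. (1 - s) / (1 - t))"
    by (intro prod.cong) (auto simp: warp_slope_def)
  finally show ?thesis
    using assms by (simp add: card_Diff_subset)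
qed

end

lemma integral_clocks_warp:
  assumes t: "0 < t" "t < 1" and s: "0 < s" "s < 1" and B: "finite B"
    and g: "g \<in> borel_measurable (clocks B)"
  shows "(\<integral>V. g V \<partial>clocks B) =
    (\<integral>V. (\<Prod>i\<in>B. warp_slope t s (V i)) * g (\<lambda>i\<in>B. warp t s (V i)) \<partial>clocks B)"
proof -
  have w: "warp t s \<in> unit_interval \<rightarrow>\<^sub>M unit_interval"
    by (rule measurable_restrict_space2) (use warp_unit[OF t s] in auto)
  have f: "(\<lambda>V. \<lambda>i\<in>B. warp t s (V i)) \<in> clocks B \<rightarrow>\<^sub>M clocks B"
    by (intro measurable_restrict measurable_compose[where g = "warp t s", OF _ w]
          measurable_component_singleton)
  have slope: "(\<lambda>V. warp_slope t s (V i)) \<in> borel_measurable (clocks B)" if "i \<in> B" for i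
    by (rule measurable_compose[OF measurable_clock[OF that]]) simp
  have "(\<integral>V. g V \<partial>clocks B) = (\<integral>V. g V \<partial>distr (density (clocks B)
      (\<lambda>V. \<Prod>i\<in>B. ennreal (warp_slope t s (V i)))) (clocks B) (\<lambda>V. \<lambda>i\<in>B. warp t s (V i)))"
    by (simp add: distr_clocks_warp[OF t s B])
  also have "\<dots> = (\<integral>V. g (\<lambda>i\<in>B. warp t s (V i)) \<partial>density (clocks B)
      (\<lambda>V. ennreal (\<Prod>i\<in>B. warp_slope t s (V i))))"
    using f g by (subst integral_distr) (simp_all add: prod_ennreal warp_slope_nonneg[OF t s])
  also have "\<dots> = (\<integral>V. (\<Prod>i\<in>B. warp_slope t s (V i)) *\<^sub>R g (\<lambda>i\<in>B. warp t s (V i)) \<partial>clocks B)"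
    using slope measurable_compose[OF f g]
    by (intro integral_density) (auto intro!: prod_nonneg warp_slope_nonneg[OF t s])
  finally show ?thesis by simp
qed

section \<open>Time derivatives of expectations of finitely many clocks\<close>

text \<open>
  The reparametrisation of the clocks by \<open>warp t s\<close> turns the expectation at time \<open>s\<close> into one
  at the fixed time \<open>t\<close>, with an explicit weight that depends only on the number \<open>j\<close> of clocks
  that have rung.
\<close>

lemma expectation_reparametrise:
  fixes G :: "real \<Rightarrow> ('i \<Rightarrow> real) \<Rightarrow> real"
  assumes t: "0 < t" "t < 1" and s: "0 < s" "s < 1" and B: "finite B" "B \<subseteq> I"
    and meas: "\<And>t J. B \<subseteq> J \<Longrightarrow> G t \<in> borel_measurable (clocks J)"
    and bound: "\<And>t U. \<bar>G t U\<bar> \<le> 1"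
    and local: "\<And>t U V. (\<And>i. i \<in> B \<Longrightarrow> U i = V i) \<Longrightarrow> G t U = G t V"
    and inv: "\<And>t U \<phi>. strict_mono \<phi> \<Longrightarrow> G (\<phi> t) (\<lambda>i. \<phi> (U i)) = G t U"
  shows "(\<integral>U. G s U \<partial>clocks I) = (\<Sum>j\<le>card B. (s / t) ^ j * ((1 - s) / (1 - t)) ^ (card B - j) *
           (\<integral>U. G t U * indicator {U. card {i \<in> B. U i \<le> t} = j} U \<partial>clocks I))"
proof -
  interpret I: product_prob_space "\<lambda>_. unit_interval" I
    by (simp add: product_prob_space_def product_prob_space_axioms_def product_sigma_finite_def
        prob_space_imp_sigma_finite prob_space_unit_interval)
  interpret PB: prob_space "clocks B" by (rule prob_space_clocks)
  have restr: "(\<lambda>U. restrict U B) \<in> clocks I \<rightarrow>\<^sub>M clocks B"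
    using B(2) by (rule measurable_restrict_subset)
  \<comment> \<open>Integrands that depend on the clocks in \<open>B\<close> only are moved to the
    finite product, where the change of variables is available.\<close>
  have toB: "(\<integral>U. g U \<partial>clocks I) = (\<integral>V. g V \<partial>clocks B)"
    if "g \<in> borel_measurable (clocks B)" and "\<And>U. g (restrict U B) = g U" for g :: "_ \<Rightarrow> real"
  proof -
    have "(\<integral>V. g V \<partial>clocks B) = (\<integral>V. g V \<partial>distr (clocks I) (clocks B) (\<lambda>U. restrict U B))"
      by (simp add: I.distr_PiM_restrict_finite[OF B])
    also have "\<dots> = (\<integral>U. g U \<partial>clocks I)"
      using restr that by (subst integral_distr) simp_all
    finally show ?thesis ..
  qed
  define N where "N U = card {i \<in> B. U i \<le> t}" for U :: "'i \<Rightarrow> real"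
  have N_le: "N U \<le> card B" for U
    unfolding N_def using B by (intro card_mono) auto
  have N_sum: "N U = (\<Sum>i\<in>B. if U i \<le> t then 1 else 0)" for U
    using B(1) by (simp add: N_def sum.If_cases Int_def)
  have [measurable]: "N \<in> clocks B \<rightarrow>\<^sub>M count_space UNIV"
    unfolding N_sum by measurable
  have [measurable]: "G t \<in> borel_measurable (clocks B)" for t
    by (rule meas) simp
  have G_restrict: "G t (restrict U B) = G t U" for t U
    by (rule local) simp
  have int: "integrable (clocks B) (\<lambda>V. G t V * indicator {U. N U = j} V)" for j
    by (rule PB.integrable_const_bound[where B = 1]) (use bound in \<open>auto simp: indicator_def\<close>)
  have "(\<integral>U. G s U \<partial>clocks I) = (\<integral>V. G s V \<partial>clocks B)"
    by (rule toB) (simp_all add: G_restrict)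
  also have "\<dots> = (\<integral>V. (\<Prod>i\<in>B. warp_slope t s (V i)) * G s (\<lambda>i\<in>B. warp t s (V i)) \<partial>clocks B)"
    by (rule integral_clocks_warp[OF t s B(1)]) simp
  also have "\<dots> = (\<integral>V. (\<Sum>j\<le>card B. (s / t) ^ j * ((1 - s) / (1 - t)) ^ (card B - j) *
      (G t V * indicator {U. N U = j} V)) \<partial>clocks B)"
  proof (intro Bochner_Integration.integral_cong refl)
    fix V
    \<comment> \<open>Order invariance is applied with \<open>\<phi> = warp t s\<close>, which sends
      \<open>t\<close> to \<open>s\<close>.\<close>
    have "G s (\<lambda>i\<in>B. warp t s (V i)) = G t V"
      using inv[OF strict_mono_warp[OF t s], of t V] G_restrict[of s "\<lambda>i. warp t s (V i)"]
      by (simp add: warp_self[OF t s])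
    moreover have "(\<Sum>j\<le>card B. (s / t) ^ j * ((1 - s) / (1 - t)) ^ (card B - j) *
        (G t V * indicator {U. N U = j} V))
      = (\<Sum>j\<le>card B. if j = N V then (s / t) ^ j * ((1 - s) / (1 - t)) ^ (card B - j) * G t V else 0)"
      by (intro sum.cong) auto
    ultimately show "(\<Prod>i\<in>B. warp_slope t s (V i)) * G s (\<lambda>i\<in>B. warp t s (V i))
      = (\<Sum>j\<le>card B. (s / t) ^ j * ((1 - s) / (1 - t)) ^ (card B - j) *
          (G t V * indicator {U. N U = j} V))"
      using N_le[of V] by (simp add: prod_warp_slope[OF t s B(1)] N_def)
  qed
  also have "\<dots> = (\<Sum>j\<le>card B. (s / t) ^ j * ((1 - s) / (1 - t)) ^ (card B - j) *
      (\<integral>V. G t V * indicator {U. N U = j} V \<partial>clocks B))"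
    using int by (subst Bochner_Integration.integral_sum) (auto intro: integrable_mult_right)
  finally have expand: "(\<integral>U. G s U \<partial>clocks I) = (\<Sum>j\<le>card B. (s / t) ^ j * ((1 - s) / (1 - t)) ^ (card B - j) *
      (\<integral>V. G t V * indicator {U. N U = j} V \<partial>clocks B))" .
  have toI: "(\<integral>V. G t V * indicator {U. N U = j} V \<partial>clocks B)
      = (\<integral>V. G t V * indicator {U. N U = j} V \<partial>clocks I)" for j
  proof (rule toB[symmetric])
    show "(\<lambda>V. G t V * indicator {U. N U = j} V) \<in> borel_measurable (clocks B)"
      by measurable
    show "G t (restrict U B) * indicator {U. N U = j} (restrict U B) = G t U * indicator {U. N U = j} U" for U
      by (simp add: G_restrict N_def indicator_def cong: conj_cong)
  qed
  show ?thesis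
    unfolding expand by (intro sum.cong refl arg_cong2[where f = "(*)"]) (simp only: toI, simp only: N_def)
qed

text \<open>After reparametrisation only the weights depend on \<open>s\<close>. They all equal 1 at
  \<open>s = t\<close>, so their derivatives there are the logarithmic derivatives
  \<open>q j\<close>. The factor \<open>\<integral>U. \<bar>G t U\<bar>\<close> in the bound is
  essential: it passes the smallness of \<open>G\<close> on to the derivative.\<close>

lemma expectation_has_bounded_derivative:
  fixes G :: "real \<Rightarrow> ('i \<Rightarrow> real) \<Rightarrow> real"
  assumes t: "0 < t" "t < 1" and B: "finite B" "B \<subseteq> I"
    and meas: "\<And>t J. B \<subseteq> J \<Longrightarrow> G t \<in> borel_measurable (clocks J)"
    and bound: "\<And>t U. \<bar>G t U\<bar> \<le> 1"
    and local: "\<And>t U V. (\<And>i. i \<in> B \<Longrightarrow> U i = V i) \<Longrightarrow> G t U = G t V"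
    and inv: "\<And>t U \<phi>. strict_mono \<phi> \<Longrightarrow> G (\<phi> t) (\<lambda>i. \<phi> (U i)) = G t U"
  obtains D where "((\<lambda>s. \<integral>U. G s U \<partial>clocks I) has_field_derivative D) (at t)"
    and "\<bar>D\<bar> \<le> card B / min t (1 - t) * (\<integral>U. \<bar>G t U\<bar> \<partial>clocks I)"
proof -
  interpret prob_space "clocks I" by (rule prob_space_clocks)
  define n where "n = card B"
  define c where "c j = (\<integral>U. G t U * indicator {U. card {i \<in> B. U i \<le> t} = j} U \<partial>clocks I)" for j
  define q where "q j = real j / t - real (n - j) / (1 - t)" for j
  define D where "D = (\<Sum>j\<le>n. q j * c j)"
  have "((\<lambda>s. (s / t) ^ j * ((1 - s) / (1 - t)) ^ (n - j) * c j) has_field_derivative q j * c j) (at t)" for j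
  proof -
    have f: "((\<lambda>s. s / t) has_field_derivative 1 / t) (at t)"
      using t by (auto intro!: derivative_eq_intros)
    have g: "((\<lambda>s. (1 - s) / (1 - t)) has_field_derivative - 1 / (1 - t)) (at t)"
      using t by (auto intro!: derivative_eq_intros simp: divide_simps)
    have one: "t / t = 1" "(1 - t) / (1 - t) = 1"
      using t by simp_all
    note DERIV_cmult_right[OF DERIV_mult[OF DERIV_power[OF f, of j] DERIV_power[OF g, of "n - j"]],
        of "c j", unfolded one power_one]
    then show ?thesis
      by (rule DERIV_cong) (simp add: q_def)
  qed
  then have "((\<lambda>s. \<Sum>j\<le>n. (s / t) ^ j * ((1 - s) / (1 - t)) ^ (n - j) * c j) has_field_derivative D) (at t)"
    unfolding D_def by (intro DERIV_sum) auto
  moreover have "\<forall>\<^sub>F s in nhds t. (\<integral>U. G s U \<partial>clocks I) = (\<Sum>j\<le>n. (s / t) ^ j * ((1 - s) / (1 - t)) ^ (n - j) * c j)"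
  proof (rule eventually_mono)
    show "\<forall>\<^sub>F s in nhds t. s \<in> {0<..<1}"
      using t by (intro eventually_nhds_in_open) auto
    show "(\<integral>U. G s U \<partial>clocks I) = (\<Sum>j\<le>n. (s / t) ^ j * ((1 - s) / (1 - t)) ^ (n - j) * c j)"
      if "s \<in> {0<..<1}" for s
      unfolding n_def c_def
      using that by (intro expectation_reparametrise[OF t _ _ B meas bound local inv]) auto
  qed
  ultimately have deriv: "((\<lambda>s. \<integral>U. G s U \<partial>clocks I) has_field_derivative D) (at t)"
    by (subst DERIV_cong_ev[OF refl _ refl])
  have [measurable]: "G t \<in> borel_measurable (clocks I)"
    using B by (intro meas)
  have "(\<lambda>U. \<Sum>i\<in>B. if U i \<le> t then 1 else 0 :: nat) \<in> clocks I \<rightarrow>\<^sub>M count_space UNIV"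
    by measurable (use B in auto)
  then have [measurable]: "(\<lambda>U. card {i \<in> B. U i \<le> t}) \<in> clocks I \<rightarrow>\<^sub>M count_space UNIV"
    using B(1) by (simp add: sum.If_cases Int_def)
  have int: "integrable (clocks I) (\<lambda>U. \<bar>G t U\<bar> * indicator {U. card {i \<in> B. U i \<le> t} = j} U)" for j
    by (rule integrable_const_bound[where B = 1]) (use bound in \<open>auto simp: indicator_def\<close>)
  \<comment> \<open>The two fractions are nonnegative with a common bound, so their difference obeys
    the same bound without a factor 2.\<close>
  have q: "\<bar>q j\<bar> \<le> n / min t (1 - t)" if "j \<le> n" for j
  proof -
    have "real j / t \<le> n / min t (1 - t)" "real (n - j) / (1 - t) \<le> n / min t (1 - t)"
      using t that by (auto intro!: frac_le)
    moreover have "0 \<le> real j / t" "0 \<le> real (n - j) / (1 - t)"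
      using t by auto
    ultimately show ?thesis unfolding q_def by linarith
  qed
  have "\<bar>D\<bar> \<le> (\<Sum>j\<le>n. \<bar>q j\<bar> * \<bar>c j\<bar>)"
    unfolding D_def by (rule order_trans[OF sum_abs]) (simp add: abs_mult)
  also have "\<dots> \<le> (\<Sum>j\<le>n. n / min t (1 - t) *
      (\<integral>U. \<bar>G t U\<bar> * indicator {U. card {i \<in> B. U i \<le> t} = j} U \<partial>clocks I))"
  proof (intro sum_mono mult_mono)
    fix j assume "j \<in> {..n}"
    have "\<bar>c j\<bar> \<le> (\<integral>U. \<bar>G t U * indicator {U. card {i \<in> B. U i \<le> t} = j} U\<bar> \<partial>clocks I)"
      unfolding c_def by (rule integral_abs_bound)
    then show "\<bar>c j\<bar> \<le> (\<integral>U. \<bar>G t U\<bar> * indicator {U. card {i \<in> B. U i \<le> t} = j} U \<partial>clocks I)"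
      by (simp add: abs_mult)
  qed (use q t in auto)
  also have "\<dots> = n / min t (1 - t) *
      (\<integral>U. (\<Sum>j\<le>n. \<bar>G t U\<bar> * indicator {U. card {i \<in> B. U i \<le> t} = j} U) \<partial>clocks I)"
    by (subst Bochner_Integration.integral_sum[OF int]) (simp only: sum_distrib_left)
  \<comment> \<open>For each \<open>U\<close> exactly one \<open>j\<close> counts the rung clocks,
    so the sum over \<open>j\<close> costs no further factor.\<close>
  also have "(\<integral>U. (\<Sum>j\<le>n. \<bar>G t U\<bar> * indicator {U. card {i \<in> B. U i \<le> t} = j} U) \<partial>clocks I)
      = (\<integral>U. \<bar>G t U\<bar> \<partial>clocks I)"
  proof (intro Bochner_Integration.integral_cong refl)
    fix U :: "'i \<Rightarrow> real"
    have "card {i \<in> B. U i \<le> t} \<le> n"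
      unfolding n_def using B by (intro card_mono) auto
    then have "(\<Sum>j\<le>n. indicator {U. card {i \<in> B. U i \<le> t} = j} U) = (1 :: real)"
      by (simp add: indicator_def)
    then show "(\<Sum>j\<le>n. \<bar>G t U\<bar> * indicator {U. card {i \<in> B. U i \<le> t} = j} U) = \<bar>G t U\<bar>"
      by (simp flip: sum_distrib_left)
  qed
  finally show ?thesis
    using that deriv by (simp add: n_def)
qed

section \<open>The graphical construction\<close>

definition unit_steps :: "(int ^ 'd::finite) set" where
  "unit_steps = {w. (\<Sum>i\<in>UNIV. \<bar>w $ i\<bar>) = 1}"

text \<open>An edge has two endpoints, and each of them meets at most one edge per unit step; this
  gives the factor 2.\<close>

definition nbr_bound :: "('d::finite) itself \<Rightarrow> nat" where
  "nbr_bound _ = 2 * card (unit_steps :: (int ^ 'd) set)"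

definition incident :: "int ^ 'd \<Rightarrow> ('d::finite) edge set" where
  "incident u = {e \<in> lattice_edges. u \<in> e}"

text \<open>An edge is its own neighbour, so \<open>paths\<close> below may stay put.\<close>

definition nbrs :: "('d::finite) edge \<Rightarrow> 'd edge set" where
  "nbrs e = {f \<in> lattice_edges. f \<inter> e \<noteq> {}}"

lemma finite_unit_steps: "finite (unit_steps :: (int ^ 'd::finite) set)"
proof (rule finite_subset)
  show "unit_steps \<subseteq> vec_lambda ` (UNIV \<rightarrow>\<^sub>E {-1..1 :: int} :: ('d \<Rightarrow> int) set)"
  proof
    fix w :: "int ^ 'd" assume "w \<in> unit_steps"
    then have "\<bar>w $ i\<bar> \<le> 1" for i
      using member_le_sum[of i UNIV "\<lambda>i. \<bar>w $ i\<bar>"] by (simp add: unit_steps_def)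
    then have "vec_nth w \<in> UNIV \<rightarrow>\<^sub>E {-1..1}"
      by (auto simp: abs_le_iff minus_le_iff)
    then show "w \<in> vec_lambda ` (UNIV \<rightarrow>\<^sub>E {-1..1})"
      by (metis image_eqI vec_nth_inverse)
  qed
qed (intro finite_imageI finite_PiE; simp)

lemma incident_subset: "incident u \<subseteq> (\<lambda>w. {u, u + w}) ` unit_steps"
proof
  fix f assume "f \<in> incident u"
  then obtain a b where f: "f = {a, b}" "(\<Sum>i\<in>UNIV. \<bar>a $ i - b $ i\<bar>) = 1" "u \<in> f"
    by (auto simp: incident_def lattice_edges_def)
  then consider "u = a" | "u = b" by auto
  then show "f \<in> (\<lambda>w. {u, u + w}) ` unit_steps"
  proof cases
    case 1
    with f show ?thesis
      by (intro image_eqI[where x = "b - a"]) (auto simp: unit_steps_def abs_minus_commute)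
  next
    case 2
    with f show ?thesis
      by (intro image_eqI[where x = "a - b"]) (auto simp: unit_steps_def)
  qed
qed

lemma finite_incident: "finite (incident u)"
  and card_incident: "card (incident (u :: int ^ 'd::finite)) \<le> card (unit_steps :: (int ^ 'd) set)"
proof -
  show "finite (incident u)"
    using incident_subset finite_unit_steps by (metis finite_imageI finite_subset)
  show "card (incident u) \<le> card (unit_steps :: (int ^ 'd) set)"
    using card_mono[OF finite_imageI[OF finite_unit_steps] incident_subset[of u]]
      card_image_le[OF finite_unit_steps, of "\<lambda>w. {u, u + w}"] by linarith
qed

lemma incident_subset_nbrs: "u \<in> e \<Longrightarrow> incident u \<subseteq> nbrs e"
  by (auto simp: incident_def nbrs_def)

lemma nbrs_lattice_edges: "f \<in> nbrs e \<Longrightarrow> f \<in> lattice_edges"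
  by (simp add: nbrs_def)

lemma self_nbrs: "e \<in> lattice_edges \<Longrightarrow> e \<in> nbrs e"
  by (auto simp: nbrs_def lattice_edges_def)

lemma nbrs_finite_card:
  fixes e :: "('d::finite) edge"
  assumes "e \<in> lattice_edges"
  shows "finite (nbrs e)" "card (nbrs e) \<le> nbr_bound TYPE('d)"
proof -
  obtain u v where e: "e = {u, v}" using assms by (auto simp: lattice_edges_def)
  have eq: "nbrs e = incident u \<union> incident v"
    by (auto simp: e nbrs_def incident_def)
  show "finite (nbrs e)" by (simp add: eq finite_incident)
  show "card (nbrs e) \<le> nbr_bound TYPE('d)"
    unfolding eq nbr_bound_def using card_Un_le[of "incident u" "incident v"] card_incident[of u] card_incident[of v]
    by linarith
qed

lemma countable_lattice_edges: "countable (lattice_edges :: ('d::finite) edge set)"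
proof (rule countable_subset)
  show "lattice_edges \<subseteq> (\<lambda>(u, v). {u, v}) ` (UNIV :: ((int ^ 'd) \<times> (int ^ 'd)) set)"
    by (auto simp: lattice_edges_def)
qed simp

section \<open>Paths of edges with decreasing clocks\<close>

primrec paths :: "nat \<Rightarrow> ('d::finite) edge \<Rightarrow> 'd edge list set" where
  "paths 0 e = {[e]}"
| "paths (Suc n) e = (\<Union>f\<in>nbrs e. (#) e ` paths n f)"

lemma paths_finite_card:
  fixes e :: "('d::finite) edge"
  assumes "e \<in> lattice_edges"
  shows "finite (paths n e) \<and> card (paths n e) \<le> nbr_bound TYPE('d) ^ n"
  using assms
proof (induction n arbitrary: e)
  case (Suc n)
  have "card (paths (Suc n) e) \<le> (\<Sum>f\<in>nbrs e. card ((#) e ` paths n f))"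
    using nbrs_finite_card[OF Suc.prems] by (simp add: card_UN_le)
  also have "\<dots> \<le> (\<Sum>f\<in>nbrs e. nbr_bound TYPE('d) ^ n)"
    using Suc.IH[OF nbrs_lattice_edges]
    by (intro sum_mono) (meson card_image_le order_trans)
  also have "\<dots> \<le> nbr_bound TYPE('d) ^ Suc n"
    using nbrs_finite_card[OF Suc.prems] by simp
  finally show ?case
    using Suc nbrs_finite_card[OF Suc.prems] by (auto intro: nbrs_lattice_edges)
qed simp

lemma paths_list:
  "e \<in> lattice_edges \<Longrightarrow> xs \<in> paths n e \<Longrightarrow>
     length xs = Suc n \<and> set xs \<subseteq> lattice_edges \<and> hd xs = e"
proof (induction n arbitrary: e xs)
  case (Suc n)
  then obtain f ys where f: "f \<in> nbrs e" "xs = e # ys" "ys \<in> paths n f"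
    by auto
  with Suc.IH[OF nbrs_lattice_edges[OF f(1)] f(3)] Suc.prems show ?case by simp
qed simp

text \<open>The order is strict, which discards all paths that stay put or return to an
  edge.\<close>

definition decreasing_path :: "nat \<Rightarrow> (('d::finite) edge \<Rightarrow> real) \<Rightarrow> 'd edge \<Rightarrow> bool" where
  "decreasing_path n U e \<longleftrightarrow> (\<exists>xs\<in>paths n e. sorted_wrt (\<lambda>f g. U g < U f) xs)"

lemma decreasing_path_0: "decreasing_path 0 U e"
  by (simp add: decreasing_path_def)

lemma decreasing_path_Suc:
  assumes "f \<in> nbrs e" "U f < U e" "decreasing_path n U f"
  shows "decreasing_path (Suc n) U e"
proof -
  obtain ys where ys: "ys \<in> paths n f" "sorted_wrt (\<lambda>f g. U g < U f) ys"
    using assms(3) by (auto simp: decreasing_path_def)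
  obtain zs where zs: "ys = f # zs"
    using paths_list[OF nbrs_lattice_edges[OF assms(1)] ys(1)] by (cases ys) auto
  have "sorted_wrt (\<lambda>f g. U g < U f) (e # ys)"
    using ys(2) assms(2) by (auto simp: zs)
  then show ?thesis
    using ys(1) assms(1) unfolding decreasing_path_def paths.simps by blast
qed

text \<open>
  Whether \<open>e\<close> ever opens depends on which adjacent edges with an earlier clock do; \<open>opens k n\<close>
  unfolds this recursion to depth \<open>n\<close> and lets no edge open at depth 0.
\<close>

primrec opens :: "nat \<Rightarrow> nat \<Rightarrow> (('d::finite) edge \<Rightarrow> real) \<Rightarrow> 'd edge \<Rightarrow> bool" where
  "opens k 0 U e = False"
| "opens k (Suc n) U e = (\<forall>u\<in>e. card {f \<in> incident u. U f < U e \<and> opens k n U f} < k)"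

text \<open>The recursion at \<open>e\<close> consults only adjacent edges with earlier clocks, so a
  disagreement at \<open>e\<close> must stem from one of them. Iterating this traces out a
  decreasing path.\<close>

lemma recursion_differs:
  assumes "(\<forall>u\<in>e. card {f \<in> incident u. U f < U e \<and> P f} < k) \<noteq>
           (\<forall>u\<in>e. card {f \<in> incident u. U f < U e \<and> Q f} < k)"
  obtains f where "f \<in> nbrs e" "U f < U e" "P f \<noteq> Q f"
proof -
  have "\<exists>f\<in>nbrs e. U f < U e \<and> P f \<noteq> Q f"
  proof (rule ccontr)
    assume *: "\<not> ?thesis"
    have "{f \<in> incident u. U f < U e \<and> P f} = {f \<in> incident u. U f < U e \<and> Q f}" if "u \<in> e" for u
      using * incident_subset_nbrs[OF that] by auto
    with assms show False by simp
  qed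
  with that show ?thesis by blast
qed

text \<open>Each level of the recursion contributes one step of the path along which the
  disagreement is traced back.\<close>

lemma decreasing_path_if_opens_differs:
  "opens k n U e \<noteq> opens k (n + m) U e \<Longrightarrow> decreasing_path n U e"
proof (induction n arbitrary: e)
  case (Suc n)
  from Suc.prems obtain f where "f \<in> nbrs e" "U f < U e" "opens k n U f \<noteq> opens k (n + m) U f"
    using recursion_differs[of e U "opens k n U" k "opens k (n + m) U"] by auto
  with Suc.IH decreasing_path_Suc show ?case by blast
qed (simp add: decreasing_path_0)

text \<open>The same tracing, now comparing an arbitrary solution of the untruncated recursion with
  the truncation; this yields uniqueness of the evolution.\<close>

lemma decreasing_path_if_fixpoint_differs:
  assumes P: "\<And>e. e \<in> lattice_edges \<Longrightarrow> P e \<longleftrightarrow> (\<forall>u\<in>e. card {f \<in> incident u. U f < U e \<and> P f} < k)"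
  shows "e \<in> lattice_edges \<Longrightarrow> P e \<noteq> opens k n U e \<Longrightarrow> decreasing_path n U e"
proof (induction n arbitrary: e)
  case (Suc n)
  from Suc.prems P[of e] obtain f where "f \<in> nbrs e" "U f < U e" "P f \<noteq> opens k n U f"
    using recursion_differs[of e U P k "opens k n U"] by auto
  with Suc.IH decreasing_path_Suc nbrs_lattice_edges show ?case by blast
qed (simp add: decreasing_path_0)

section \<open>The limit of the truncated recursion\<close>

definition opens_limit :: "nat \<Rightarrow> (('d::finite) edge \<Rightarrow> real) \<Rightarrow> 'd edge \<Rightarrow> bool" where
  "opens_limit k U e \<longleftrightarrow> (\<forall>\<^sub>F n in sequentially. opens k n U e)"

text \<open>Any change of the answer after depth \<open>n\<close> would produce a decreasing path
  with \<open>n\<close> steps, so the answers are constant from depth \<open>n\<close> on.\<close>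

lemma opens_limit_eq:
  assumes "\<not> decreasing_path n U e"
  shows "opens_limit k U e \<longleftrightarrow> opens k n U e"
    and "\<forall>\<^sub>F m in sequentially. opens k m U e \<longleftrightarrow> opens_limit k U e"
proof -
  have *: "\<forall>\<^sub>F m in sequentially. opens k m U e \<longleftrightarrow> opens k n U e"
    unfolding eventually_sequentially
  proof (intro exI allI impI)
    fix m assume "n \<le> m"
    then show "opens k m U e \<longleftrightarrow> opens k n U e"
      using assms decreasing_path_if_opens_differs[of k n U e "m - n"] by auto
  qed
  then have "(\<forall>\<^sub>F m in sequentially. opens k m U e) \<longleftrightarrow> (\<forall>\<^sub>F m::nat in sequentially. opens k n U e)"
    by (rule eventually_cong) simp
  then show eq: "opens_limit k U e \<longleftrightarrow> opens k n U e"
    by (simp add: opens_limit_def)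
  show "\<forall>\<^sub>F m in sequentially. opens k m U e \<longleftrightarrow> opens_limit k U e"
    using * unfolding eq .
qed

text \<open>The depth \<open>n\<close> may vary with the edge. Positive clocks are compatible with
  all edges being closed at time 0, and they leave a time \<open>s\<close> with
  \<open>0 \<le> s < U e\<close> at which the constraint is tested.\<close>

definition regular_clocks :: "(('d::finite) edge \<Rightarrow> real) \<Rightarrow> bool" where
  "regular_clocks U \<longleftrightarrow> (\<forall>e\<in>lattice_edges. 0 < U e \<and> (\<exists>n. \<not> decreasing_path n U e))"

text \<open>An edge has finitely many neighbours, so some depth \<open>m\<close> is final for all of
  them while \<open>Suc m\<close> is final for \<open>e\<close>. One unfolding at that depth is the
  equation for the limit.\<close>

lemma opens_limit_fixpoint:
  assumes "regular_clocks U" "e \<in> lattice_edges"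
  shows "opens_limit k U e \<longleftrightarrow> (\<forall>u\<in>e. card {f \<in> incident u. U f < U e \<and> opens_limit k U f} < k)"
proof -
  have ev: "\<forall>\<^sub>F m in sequentially. opens k m U f \<longleftrightarrow> opens_limit k U f" if "f \<in> lattice_edges" for f
    using assms(1) that opens_limit_eq(2) unfolding regular_clocks_def by blast
  have "\<forall>\<^sub>F m in sequentially. \<forall>f\<in>nbrs e. opens k m U f \<longleftrightarrow> opens_limit k U f"
    using ev nbrs_finite_card(1)[OF assms(2)] nbrs_lattice_edges
    by (intro eventually_ball_finite) auto
  moreover have "\<forall>\<^sub>F m in sequentially. opens k (Suc m) U e \<longleftrightarrow> opens_limit k U e"
    using ev[OF assms(2)] by (subst eventually_sequentially_Suc)
  ultimately have "\<forall>\<^sub>F m in sequentially. (\<forall>f\<in>nbrs e. opens k m U f \<longleftrightarrow> opens_limit k U f) \<and>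
      (opens k (Suc m) U e \<longleftrightarrow> opens_limit k U e)"
    by (rule eventually_conj)
  then obtain m where m: "\<forall>f\<in>nbrs e. opens k m U f \<longleftrightarrow> opens_limit k U f"
      "opens k (Suc m) U e \<longleftrightarrow> opens_limit k U e"
    using eventually_happens'[OF sequentially_bot] by blast
  have "{f \<in> incident u. U f < U e \<and> opens k m U f} = {f \<in> incident u. U f < U e \<and> opens_limit k U f}"
    if "u \<in> e" for u
    using m(1) incident_subset_nbrs[OF that] by auto
  with m(2) show ?thesis by auto
qed

section \<open>Existence and uniqueness of the evolution\<close>

lemma open_degree_eq_card_incident: "open_degree \<eta> u = card {f \<in> incident u. \<eta> f = 1}"
proof -
  have "bij_betw (\<lambda>x. {x, u}) {x. {x, u} \<in> lattice_edges \<and> \<eta> {x, u} = 1} {f \<in> incident u. \<eta> f = 1}"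
  proof (rule bij_betwI')
    fix f assume f: "f \<in> {f \<in> incident u. \<eta> f = 1}"
    then obtain a b where "f = {a, b}" "u \<in> f"
      by (auto simp: incident_def lattice_edges_def)
    then obtain x where "f = {x, u}" by auto
    with f show "\<exists>x\<in>{x. {x, u} \<in> lattice_edges \<and> \<eta> {x, u} = 1}. f = {x, u}"
      by (auto simp: incident_def)
  qed (auto simp: incident_def doubleton_eq_iff)
  then show ?thesis by (simp add: open_degree_def bij_betw_same_card)
qed

text \<open>Open degrees grow with time and only finitely many edges meet a vertex. The constraint
  at all times before \<open>U e\<close> is therefore decided at the last incident clock before
  \<open>U e\<close>, and time disappears from the condition.\<close>

lemma degree_constraint_iff:
  fixes U :: "('d::finite) edge \<Rightarrow> real"
  assumes \<omega>: "\<And>t f. f \<in> lattice_edges \<Longrightarrow> \<omega> t f = 1 \<longleftrightarrow> U f \<le> t \<and> P f"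
    and e: "e \<in> lattice_edges" and pos: "0 < U e"
  shows "(\<forall>s u v. 0 \<le> s \<and> s < U e \<and> e = {u, v} \<longrightarrow>
            max (open_degree (\<omega> s) u) (open_degree (\<omega> s) v) < k) \<longleftrightarrow>
         (\<forall>u\<in>e. card {f \<in> incident u. U f < U e \<and> P f} < k)" (is "?L \<longleftrightarrow> ?R")
proof
  have deg: "open_degree (\<omega> s) u = card {f \<in> incident u. U f \<le> s \<and> P f}" for s u
    unfolding open_degree_eq_card_incident
    by (rule arg_cong[where f = card]) (use \<omega> in \<open>auto simp: incident_def\<close>)
  {
    assume ?L
    show ?R
    proof
      fix u assume u: "u \<in> e"
      then obtain v where v: "e = {u, v}" using e by (auto simp: lattice_edges_def)
      define F where "F = U ` {f \<in> incident u. U f < U e}"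
      have F: "finite (insert 0 F)" by (simp add: F_def finite_incident)
      \<comment> \<open>The inserted 0 keeps the set nonempty and \<open>s\<close> nonnegative. At
        time \<open>s\<close> every incident edge with a clock before \<open>U e\<close> has
        rung.\<close>
      define s where "s = Max (insert 0 F)"
      have s: "0 \<le> s" "s < U e"
        using F pos by (auto simp: s_def F_def)
      have "card {f \<in> incident u. U f < U e \<and> P f} \<le> card {f \<in> incident u. U f \<le> s \<and> P f}"
        using F by (intro card_mono) (auto simp: finite_incident s_def F_def intro!: Max_ge)
      also have "\<dots> = open_degree (\<omega> s) u" by (simp add: deg)
      also have "\<dots> < k" using \<open>?L\<close> s v by force
      finally show "card {f \<in> incident u. U f < U e \<and> P f} < k" .
    qed
  next
    assume R: ?R
    show ?L
    proof (intro allI impI)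
      fix s u v assume s: "0 \<le> s \<and> s < U e \<and> e = {u, v}"
      have "open_degree (\<omega> s) x < k" if "x \<in> e" for x
      proof -
        have "open_degree (\<omega> s) x \<le> card {f \<in> incident x. U f < U e \<and> P f}"
          unfolding deg using s by (intro card_mono) (auto simp: finite_incident)
        also have "\<dots> < k" using R that by blast
        finally show ?thesis .
      qed
      with s show "max (open_degree (\<omega> s) u) (open_degree (\<omega> s) v) < k" by simp
    qed
  }
qed

definition limit_config :: "nat \<Rightarrow> real \<Rightarrow> (('d::finite) edge \<Rightarrow> real) \<Rightarrow> 'd edge \<Rightarrow> nat" where
  "limit_config k t U = (\<lambda>e\<in>lattice_edges. if U e \<le> t \<and> opens_limit k U e then 1 else 0)"

text \<open>Existence is the fixed-point equation for \<open>opens_limit\<close>. For uniqueness,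
  the opening condition of any evolution solves the same equation and hence agrees with every
  sufficiently deep truncation.\<close>

lemma cdp_eq_limit_config:
  assumes U: "regular_clocks U"
  shows "cdp k t U = limit_config k t U"
proof -
  have pos: "0 < U e" if "e \<in> lattice_edges" for e
    using U that by (simp add: regular_clocks_def)
  have config_1: "limit_config k t U f = 1 \<longleftrightarrow> U f \<le> t \<and> opens_limit k U f"
    if "f \<in> lattice_edges" for t f
    using that by (simp add: limit_config_def)
  have "cdp_evolution k U (\<lambda>t. limit_config k t U)"
    unfolding cdp_evolution_def
  proof (intro conjI allI ballI)
    show "limit_config k t U \<in> configurations" for t
      by (auto simp: limit_config_def configurations_def)
    show "limit_config k 0 U e = 0" if "e \<in> lattice_edges" for e
      using pos[OF that] that by (simp add: limit_config_def)
    show "limit_config k t U e = 1 \<longleftrightarrow> U e \<le> t \<and>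
        (\<forall>s u v. 0 \<le> s \<and> s < U e \<and> e = {u, v} \<longrightarrow>
           max (open_degree (limit_config k s U) u) (open_degree (limit_config k s U) v) < k)"
      if e: "e \<in> lattice_edges" for t e
      using degree_constraint_iff[of "\<lambda>t. limit_config k t U" U "opens_limit k U" e k, OF config_1 e pos[OF e]]
        opens_limit_fixpoint[OF U e] config_1[OF e] by simp
  qed
  moreover have "\<omega> = (\<lambda>t. limit_config k t U)" if evo: "cdp_evolution k U \<omega>" for \<omega>
  proof -
    define P where "P e \<longleftrightarrow> (\<forall>s u v. 0 \<le> s \<and> s < U e \<and> e = {u, v} \<longrightarrow>
           max (open_degree (\<omega> s) u) (open_degree (\<omega> s) v) < k)" for e
    have \<omega>: "\<omega> t e = 1 \<longleftrightarrow> U e \<le> t \<and> P e" if "e \<in> lattice_edges" for t e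
      using evo that by (simp add: cdp_evolution_def P_def)
    have P: "P e \<longleftrightarrow> (\<forall>u\<in>e. card {f \<in> incident u. U f < U e \<and> P f} < k)" if "e \<in> lattice_edges" for e
      using degree_constraint_iff[of \<omega> U P e k, OF \<omega> that pos[OF that]] by (simp add: P_def)
    have P_eq: "P e \<longleftrightarrow> opens_limit k U e" if e: "e \<in> lattice_edges" for e
    proof -
      obtain n where n: "\<not> decreasing_path n U e"
        using U e by (auto simp: regular_clocks_def)
      show ?thesis
        using decreasing_path_if_fixpoint_differs[OF P e] opens_limit_eq(1)[OF n] n by blast
    qed
    show ?thesis
    proof (intro ext)
      fix t e
      \<comment> \<open>Membership in \<open>configurations\<close> fixes the values off the lattice
        and allows only 0 and 1 on it, so agreement about the value 1 is equality of
        functions.\<close>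
      have "\<omega> t \<in> configurations" using evo by (simp add: cdp_evolution_def)
      then have "e \<notin> lattice_edges \<longrightarrow> \<omega> t e = undefined" "e \<in> lattice_edges \<longrightarrow> \<omega> t e \<in> {0, 1}"
        by (auto simp: configurations_def PiE_iff extensional_def)
      with \<omega>[of e t] P_eq[of e] show "\<omega> t e = limit_config k t U e"
        by (auto simp: limit_config_def)
    qed
  qed
  ultimately have "(THE \<omega>. cdp_evolution k U \<omega>) = (\<lambda>t. limit_config k t U)"
    by (rule the_equality)
  then show ?thesis by (simp add: cdp_def)
qed

section \<open>Dependence of the truncated recursion on finitely many clocks\<close>

definition reach :: "nat \<Rightarrow> ('d::finite) edge \<Rightarrow> 'd edge set" where
  "reach n e = (\<Union>xs\<in>paths n e. set xs)"

lemma reach_Suc: "e \<in> lattice_edges \<Longrightarrow> f \<in> nbrs e \<Longrightarrow> reach n f \<subseteq> reach (Suc n) e"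
  by (auto simp: reach_def)

lemma paths_nonempty: "e \<in> lattice_edges \<Longrightarrow> paths n e \<noteq> {}"
proof (induction n arbitrary: e)
  case (Suc n)
  with self_nbrs[OF Suc.prems] show ?case by force
qed simp

lemma self_reach: "e \<in> lattice_edges \<Longrightarrow> e \<in> reach n e"
  using paths_nonempty[of e n] paths_list[of e _ n]
  by (fastforce simp: reach_def intro: list.set_sel(1))

lemma reach_lattice_edges: "e \<in> lattice_edges \<Longrightarrow> reach n e \<subseteq> lattice_edges"
  using paths_list by (fastforce simp: reach_def)

lemma reach_finite_card:
  fixes e :: "('d::finite) edge"
  assumes e: "e \<in> lattice_edges"
  shows "finite (reach n e)"
    and "card (reach n e) \<le> nbr_bound TYPE('d) ^ n * Suc n"
proof -
  show "finite (reach n e)"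
    using paths_finite_card[OF e] by (simp add: reach_def)
  have "card (reach n e) \<le> (\<Sum>xs\<in>paths n e. card (set xs))"
    unfolding reach_def using paths_finite_card[OF e] by (intro card_UN_le) auto
  also have "\<dots> \<le> (\<Sum>xs\<in>paths n e. Suc n)"
    using paths_list[OF e] by (intro sum_mono) (metis card_length)
  also have "\<dots> \<le> nbr_bound TYPE('d) ^ n * Suc n"
    using paths_finite_card[OF e, of n] by (simp only: sum_constant mult_le_mono1 of_nat_id)
  finally show "card (reach n e) \<le> nbr_bound TYPE('d) ^ n * Suc n" .
qed

lemma opens_local:
  "e \<in> lattice_edges \<Longrightarrow> (\<And>f. f \<in> reach n e \<Longrightarrow> U f = V f) \<Longrightarrow> opens k n U e = opens k n V e"
proof (induction n arbitrary: e)
  case (Suc n)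
  have "{f \<in> incident u. U f < U e \<and> opens k n U f} = {f \<in> incident u. V f < V e \<and> opens k n V f}"
    if u: "u \<in> e" for u
  proof -
    have eq: "U g = V g" if "f \<in> nbrs e" "g \<in> reach n f" for f g
      using Suc.prems reach_Suc that by blast
    have "U f = V f \<and> (opens k n U f \<longleftrightarrow> opens k n V f)" if "f \<in> incident u" for f
    proof -
      have f: "f \<in> nbrs e" using incident_subset_nbrs[OF u] that by blast
      show ?thesis
        using Suc.IH[OF nbrs_lattice_edges[OF f] eq[OF f]] eq[OF f self_reach[OF nbrs_lattice_edges[OF f]]]
        by simp
    qed
    moreover have "U e = V e" using Suc.prems(1) self_reach by (intro Suc.prems(2))
    ultimately show ?thesis by auto
  qed
  then show ?case by simp
qed simp

text \<open>The recursion only compares clocks; this is the order invariance required by the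
  derivative bound.\<close>

lemma opens_strict_mono: "strict_mono \<phi> \<Longrightarrow> opens k n (\<lambda>f. \<phi> (U f)) e = opens k n U e"
  by (induction n arbitrary: e) (simp_all add: strict_mono_less)

text \<open>The index set \<open>J\<close> is left open because the derivative bound needs
  measurability both on the finite product and on all edges.\<close>

lemma opens_measurable:
  "e \<in> lattice_edges \<Longrightarrow> reach n e \<subseteq> J \<Longrightarrow> Measurable.pred (clocks J) (\<lambda>U. opens k n U e)"
proof (induction n arbitrary: e)
  case (Suc n)
  have "Measurable.pred (clocks J) (\<lambda>U. card {f \<in> incident u. U f < U e \<and> opens k n U f} < k)"
    if u: "u \<in> e" for u
  proof -
    have [measurable]: "(\<lambda>U. U e) \<in> borel_measurable (clocks J)"
      using Suc.prems self_reach by (intro measurable_clock) auto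
    have [measurable]: "Measurable.pred (clocks J) (\<lambda>U. opens k n U f)"
        "(\<lambda>U. U f) \<in> borel_measurable (clocks J)" if "f \<in> incident u" for f
    proof -
      have f: "f \<in> nbrs e" using incident_subset_nbrs[OF u] that by blast
      then have "reach n f \<subseteq> J" using Suc.prems reach_Suc by blast
      with Suc.IH[OF nbrs_lattice_edges[OF f]] self_reach[OF nbrs_lattice_edges[OF f], of n]
      show "Measurable.pred (clocks J) (\<lambda>U. opens k n U f)"
        "(\<lambda>U. U f) \<in> borel_measurable (clocks J)" by auto
    qed
    have "Measurable.pred (clocks J)
        (\<lambda>U. (\<Sum>f\<in>incident u. if U f < U e \<and> opens k n U f then 1 else 0) < k)"
      by measurable
    then show ?thesis
      using finite_incident[of u] by (simp add: sum.If_cases Int_def)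
  qed
  moreover have "finite e"
    using Suc.prems(1) by (auto simp: lattice_edges_def)
  ultimately show ?case
    by (simp add: pred_intros_finite)
qed simp

section \<open>Decreasing paths are rare\<close>

abbreviation edge_clocks :: "(('d::finite) edge \<Rightarrow> real) measure" where
  "edge_clocks \<equiv> clocks lattice_edges"

lemma sorted_wrt_clocks_measurable:
  "set xs \<subseteq> J \<Longrightarrow> Measurable.pred (clocks J) (\<lambda>U. sorted_wrt (\<lambda>i j. U j < U i) xs)"
proof (induction xs)
  case (Cons x xs)
  have [measurable]: "(\<lambda>U. U y) \<in> borel_measurable (clocks J)" if "y \<in> set (x # xs)" for y
    using that Cons.prems by (intro measurable_clock) auto
  have [measurable]: "Measurable.pred (clocks J) (\<lambda>U. sorted_wrt (\<lambda>i j. U j < U i) xs)"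
    using Cons by simp
  have "Measurable.pred (clocks J) (\<lambda>U. (\<forall>y\<in>set xs. U y < U x) \<and> sorted_wrt (\<lambda>i j. U j < U i) xs)"
    by measurable (use Cons.prems in auto)
  then show ?case by simp
qed simp

lemma decreasing_path_measurable:
  assumes "e \<in> lattice_edges"
  shows "Measurable.pred edge_clocks (\<lambda>U. decreasing_path n U e)"
  unfolding decreasing_path_def
  using paths_finite_card[OF assms, of n] paths_list[OF assms]
  by (intro pred_intros_finite sorted_wrt_clocks_measurable) auto

text \<open>Union bound over the paths; \<open>n\<close> steps visit \<open>n + 1\<close> edges,
  whence the factorial of \<open>Suc n\<close>.\<close>

lemma prob_decreasing_path_le:
  fixes e :: "('d::finite) edge"
  assumes e: "e \<in> lattice_edges"
  shows "measure edge_clocks {U \<in> space edge_clocks. decreasing_path n U e}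
           \<le> nbr_bound TYPE('d) ^ n / fact (Suc n)"
proof -
  interpret prob_space "edge_clocks :: ('d edge \<Rightarrow> real) measure" by (rule prob_space_clocks)
  define S where "S xs = {U \<in> space edge_clocks. sorted_wrt (\<lambda>f g. U g < U f) xs}" for xs :: "'d edge list"
  have "S xs \<in> events" if "xs \<in> paths n e" for xs
    using sorted_wrt_clocks_measurable[of xs lattice_edges] paths_list[OF e that]
    by (simp add: S_def pred_def)
  moreover have "{U \<in> space edge_clocks. decreasing_path n U e} = (\<Union>xs\<in>paths n e. S xs)"
    by (auto simp: S_def decreasing_path_def)
  ultimately have "prob {U \<in> space edge_clocks. decreasing_path n U e} \<le> (\<Sum>xs\<in>paths n e. prob (S xs))"
    using paths_finite_card[OF e] by (auto intro!: finite_measure_subadditive_finite)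
  also have "\<dots> \<le> (\<Sum>xs\<in>paths n e. 1 / fact (Suc n))"
  proof (rule sum_mono)
    fix xs assume "xs \<in> paths n e"
    from paths_list[OF e this] show "prob (S xs) \<le> 1 / fact (Suc n)"
      using prob_decreasing_le[of xs lattice_edges] by (simp add: S_def del: fact_Suc)
  qed
  also have "\<dots> = card (paths n e) / fact (Suc n)"
    by simp
  also have "\<dots> \<le> nbr_bound TYPE('d) ^ n / fact (Suc n)"
    using paths_finite_card[OF e, of n] by (intro divide_right_mono) (simp_all flip: of_nat_power)
  finally show ?thesis .
qed

section \<open>Almost every family of clocks is regular\<close>

lemma summable_power_over_fact: "summable (\<lambda>n. (x :: real) ^ n / fact n)"
  using summable_exp[of x] by (simp add: field_simps)

text \<open>There are countably many edges. For a single one, the event of having decreasing paths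
  of every length has probability at most \<open>x ^ n / fact n\<close> for each \<open>n\<close>,
  hence 0.\<close>

lemma AE_regular_clocks: "AE U in edge_clocks. regular_clocks (U :: ('d::finite) edge \<Rightarrow> real)"
  unfolding regular_clocks_def
proof (subst AE_ball_countable[OF countable_lattice_edges], intro ballI)
  fix e :: "'d edge" assume e: "e \<in> lattice_edges"
  interpret prob_space "edge_clocks :: ('d edge \<Rightarrow> real) measure" by (rule prob_space_clocks)
  define x where "x = real (nbr_bound TYPE('d))"
  have "AE v in unit_interval. 0 < v"
    using AE_lborel_singleton[of "0 :: real"] by (auto simp: AE_restrict_space_iff)
  then have "AE U in edge_clocks. 0 < U e"
    by (intro AE_PiM_component e prob_space_unit_interval)
  moreover have "AE U in edge_clocks. \<exists>n. \<not> decreasing_path n U e"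
  proof -
    define N where "N = {U \<in> space edge_clocks. \<forall>n. decreasing_path n U e}"
    note [measurable] = decreasing_path_measurable[OF e]
    have N: "N \<in> events" unfolding N_def by measurable
    have "prob N \<le> x ^ n / fact n" for n
    proof -
      have "prob N \<le> prob {U \<in> space edge_clocks. decreasing_path n U e}"
        by (intro finite_measure_mono) (auto simp: N_def)
      also have "\<dots> \<le> x ^ n / fact (Suc n)"
        using prob_decreasing_path_le[OF e, of n] by (simp add: x_def)
      also have "\<dots> \<le> x ^ n / fact n"
        by (intro divide_left_mono fact_mono) (auto simp: x_def)
      finally show ?thesis .
    qed
    then have "prob N \<le> 0"
      using LIMSEQ_le_const[OF summable_LIMSEQ_zero[OF summable_power_over_fact[of x]]] by blast
    then have "prob N = 0" by (simp add: measure_le_0_iff)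
    then have "N \<in> null_sets edge_clocks"
      using N by (simp add: null_sets_def emeasure_eq_measure)
    then show ?thesis
      by (rule AE_I') (auto simp: N_def)
  qed
  ultimately show "AE U in edge_clocks. 0 < U e \<and> (\<exists>n. \<not> decreasing_path n U e)"
    by eventually_elim simp
qed

section \<open>Measurability and probability of the local event\<close>

lemma pred_random_subset:
  assumes K: "finite K" and P: "\<And>e. e \<in> K \<Longrightarrow> Measurable.pred M (P e)"
  shows "Measurable.pred M (\<lambda>U. {e \<in> K. P e U} \<in> \<A>)"
proof -
  \<comment> \<open>Only finitely many subsets of \<open>K\<close> can occur, so an arbitrary family
    \<open>\<A>\<close> reduces to a finite disjunction.\<close>
  have "{e \<in> K. P e U} \<in> \<A> \<longleftrightarrow> (\<exists>T\<in>\<A> \<inter> Pow K. \<forall>e\<in>K. P e U = (e \<in> T))" for U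
  proof
    assume "{e \<in> K. P e U} \<in> \<A>"
    then show "\<exists>T\<in>\<A> \<inter> Pow K. \<forall>e\<in>K. P e U = (e \<in> T)"
      by (intro bexI[of _ "{e \<in> K. P e U}"]) auto
  next
    assume "\<exists>T\<in>\<A> \<inter> Pow K. \<forall>e\<in>K. P e U = (e \<in> T)"
    then obtain T where T: "T \<in> \<A>" "T \<subseteq> K" "\<forall>e\<in>K. P e U = (e \<in> T)" by blast
    then have "{e \<in> K. P e U} = T" by auto
    with T show "{e \<in> K. P e U} \<in> \<A>" by simp
  qed
  moreover have "Measurable.pred M (\<lambda>U. \<exists>T\<in>\<A> \<inter> Pow K. \<forall>e\<in>K. P e U = (e \<in> T))"
    using K by (intro pred_intros_finite) (auto intro!: pred_intros_logic P)
  ultimately show ?thesis by simp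
qed

lemma clock_le_measurable: "e \<in> J \<Longrightarrow> Measurable.pred (clocks J) (\<lambda>U. U e \<le> t)"
  by measurable

lemma opens_limit_measurable:
  assumes "e \<in> lattice_edges"
  shows "Measurable.pred edge_clocks (\<lambda>U. opens_limit k U e)"
proof -
  have [measurable]: "Measurable.pred edge_clocks (\<lambda>U. opens k n U e)" for n
    using assms reach_lattice_edges by (intro opens_measurable) auto
  show ?thesis
    unfolding opens_limit_def eventually_sequentially by measurable
qed

text \<open>Since \<open>A\<close> lives on \<open>K\<close>, membership can be read off from the
  set of open edges in \<open>K\<close>; \<open>\<A>\<close> is the corresponding family of sets.
  For regular clocks the model coincides with \<open>limit_config\<close>.\<close>

lemma cdp_prob_eq:
  fixes A :: "(('d::finite) edge \<Rightarrow> nat) set"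
  assumes K: "finite K" "K \<subseteq> lattice_edges" and A: "A \<subseteq> configurations" "lives_on A K"
  defines "\<A> \<equiv> {T. \<exists>\<eta>\<in>A. \<forall>e\<in>K. \<eta> e = 1 \<longleftrightarrow> e \<in> T}"
  shows "cdp_prob k A t =
    measure edge_clocks {U \<in> space edge_clocks. {e \<in> K. U e \<le> t \<and> opens_limit k U e} \<in> \<A>}"
proof -
  define Y where "Y = {U \<in> space edge_clocks. {e \<in> K. U e \<le> t \<and> opens_limit k U e} \<in> \<A>}"
  define X where "X = cdp k t -` A \<inter> space (edge_clocks :: ('d edge \<Rightarrow> real) measure)"
  have "Measurable.pred edge_clocks (\<lambda>U. {e \<in> K. U e \<le> t \<and> opens_limit k U e} \<in> \<A>)"
    using K by (intro pred_random_subset pred_intros_logic clock_le_measurable opens_limit_measurable) auto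
  then have Y: "Y \<in> sets edge_clocks" by (simp add: Y_def pred_def)
  have in_A_iff: "limit_config k t U \<in> A \<longleftrightarrow> {e \<in> K. U e \<le> t \<and> opens_limit k U e} \<in> \<A>" for U
  proof
    assume "limit_config k t U \<in> A"
    then show "{e \<in> K. U e \<le> t \<and> opens_limit k U e} \<in> \<A>"
      using K(2) unfolding \<A>_def
      by (intro CollectI bexI[of _ "limit_config k t U"]) (auto simp: limit_config_def subset_iff)
  next
    assume "{e \<in> K. U e \<le> t \<and> opens_limit k U e} \<in> \<A>"
    then obtain \<eta> where \<eta>: "\<eta> \<in> A" "\<forall>e\<in>K. \<eta> e = 1 \<longleftrightarrow> U e \<le> t \<and> opens_limit k U e"
      by (auto simp: \<A>_def)
    have "limit_config k t U e = \<eta> e" if e: "e \<in> K" for e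
    proof -
      have "\<eta> e \<in> {0, 1}" using \<eta>(1) A(1) K(2) e by (auto simp: configurations_def)
      moreover have "e \<in> lattice_edges" using K(2) e by blast
      ultimately show ?thesis using \<eta>(2) e by (auto simp: limit_config_def)
    qed
    moreover have "limit_config k t U \<in> configurations"
      by (auto simp: limit_config_def configurations_def)
    ultimately show "limit_config k t U \<in> A"
      using A(2) \<eta>(1) by (auto simp: lives_on_def)
  qed
  obtain N where N: "N \<in> null_sets edge_clocks"
      "{U \<in> space edge_clocks. \<not> regular_clocks (U :: 'd edge \<Rightarrow> real)} \<subseteq> N"
    using AE_regular_clocks by (auto simp: eventually_ae_filter)
  have eq: "U \<in> X \<longleftrightarrow> U \<in> Y" if "U \<notin> N" for U
    using that N(2) in_A_iff cdp_eq_limit_config[of U k t] by (auto simp: X_def Y_def)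
  \<comment> \<open>On \<open>N\<close> nothing is known about \<open>cdp\<close>, so
    \<open>X\<close> is obtained as a measurable set plus part of a null set, which the completion
    accepts.\<close>
  have "X = (Y - N) \<union> (X \<inter> N)" using eq by blast
  moreover have "(Y - N) \<union> (X \<inter> N) \<in> sets (completion edge_clocks)"
    by (rule sets_completionI[OF refl _ N(1)]) (use Y N in auto)
  ultimately have X: "X \<in> sets (completion edge_clocks)" by simp
  have "measure (completion edge_clocks) X = measure (completion edge_clocks) Y"
  proof (rule measure_eq_AE)
    have "AE U in completion edge_clocks. U \<notin> N"
      using N(1) by (intro AE_completion AE_not_in)
    then show "AE U in completion edge_clocks. U \<in> X \<longleftrightarrow> U \<in> Y"
      by eventually_elim (rule eq)
  qed (use X Y in auto)
  then show ?thesis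
    using Y by (simp add: cdp_prob_def clock_measure_def X_def Y_def)
qed

text \<open>The integrand is the indicator of disagreement, which is covered by the decreasing-path
  events of the edges in \<open>K\<close>.\<close>

lemma expectation_differ_le:
  fixes P Q :: "(('d::finite) edge \<Rightarrow> real) \<Rightarrow> bool"
  assumes K: "finite K" "K \<subseteq> lattice_edges"
    and P: "Measurable.pred edge_clocks P" and Q: "Measurable.pred edge_clocks Q"
    and differ: "\<And>U. P U \<noteq> Q U \<Longrightarrow> \<exists>e\<in>K. decreasing_path n U e"
  shows "(\<integral>U. \<bar>of_bool (P U) - of_bool (Q U)\<bar> \<partial>edge_clocks)
           \<le> card K * nbr_bound TYPE('d) ^ n / fact (Suc n)"
proof -
  interpret prob_space "edge_clocks :: ('d edge \<Rightarrow> real) measure" by (rule prob_space_clocks)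
  define S where "S e = {U \<in> space edge_clocks. decreasing_path n U e}" for e :: "'d edge"
  have S: "S e \<in> events" if "e \<in> K" for e
    using decreasing_path_measurable[of e n] that K by (auto simp: S_def pred_def)
  have meas: "{U \<in> space edge_clocks. P U \<noteq> Q U} \<in> events"
    using P Q by measurable
  have "(\<integral>U. \<bar>of_bool (P U) - of_bool (Q U)\<bar> \<partial>edge_clocks)
      = (\<integral>U. indicator {U \<in> space edge_clocks. P U \<noteq> Q U} U \<partial>edge_clocks :: real)"
    by (intro Bochner_Integration.integral_cong) (auto simp: indicator_def)
  also have "\<dots> = prob {U \<in> space edge_clocks. P U \<noteq> Q U}"
    using meas by simp
  also have "\<dots> \<le> prob (\<Union>e\<in>K. S e)"
    using S K differ by (intro finite_measure_mono) (auto simp: S_def)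
  also have "\<dots> \<le> (\<Sum>e\<in>K. prob (S e))"
    using S K by (intro finite_measure_subadditive_finite) auto
  also have "\<dots> \<le> (\<Sum>e\<in>K. nbr_bound TYPE('d) ^ n / fact (Suc n))"
    using K prob_decreasing_path_le unfolding S_def by (intro sum_mono) auto
  finally show ?thesis by simp
qed

section \<open>Differentiability\<close>

theorem proposition3:
  fixes k :: nat and A :: "(('d::finite) edge \<Rightarrow> nat) set"
  assumes "0 < k" and "k \<le> 2 * CARD('d)"
    and "local_event A"
  shows "(\<lambda>t. cdp_prob k A t) differentiable_on {0<..<1}"
proof -
  interpret prob_space "edge_clocks :: ('d edge \<Rightarrow> real) measure" by (rule prob_space_clocks)
  obtain K where A: "A \<subseteq> configurations" "lives_on A K" and K: "finite K" "K \<subseteq> lattice_edges"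
    using assms(3) by (auto simp: local_event_def)
  define \<A> where "\<A> = {T. \<exists>\<eta>\<in>A. \<forall>e\<in>K. \<eta> e = 1 \<longleftrightarrow> e \<in> T}"
  define x where "x = real (nbr_bound TYPE('d))"
  have x: "0 \<le> x" by (simp add: x_def)
  define p where "p n = card K * x ^ n / fact (Suc n)" for n
  define occurs where "occurs n t U \<longleftrightarrow> {e \<in> K. U e \<le> t \<and> opens k n U e} \<in> \<A>" for n t U
  define occurs_lim where "occurs_lim t U \<longleftrightarrow> {e \<in> K. U e \<le> t \<and> opens_limit k U e} \<in> \<A>" for t U
  define F where "F n t = (\<integral>U. of_bool (occurs n t U) \<partial>edge_clocks :: real)" for n t
  define G where "G n t U = (of_bool (occurs (Suc n) t U) - of_bool (occurs n t U) :: real)" for n t U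
  \<comment> \<open>Depth \<open>Suc n\<close>, because \<open>G n\<close> compares the truncations
    at depths \<open>n\<close> and \<open>Suc n\<close>.\<close>
  define B where "B n = (\<Union>e\<in>K. reach (Suc n) e)" for n

  have reach_B: "reach n e \<subseteq> B n" "reach (Suc n) e \<subseteq> B n" if "e \<in> K" for e n
    using that K reach_Suc[OF _ self_nbrs] by (fastforce simp: B_def)+
  have B: "finite (B n)" "B n \<subseteq> lattice_edges" for n
    using K reach_finite_card(1) reach_lattice_edges unfolding B_def by blast+
  have card_B: "card (B n) \<le> card K * x ^ Suc n * (n + 2)" for n
  proof -
    have "card (B n) \<le> (\<Sum>e\<in>K. card (reach (Suc n) e))"
      unfolding B_def by (rule card_UN_le[OF K(1)])
    also have "\<dots> \<le> (\<Sum>e\<in>K. nbr_bound TYPE('d) ^ Suc n * Suc (Suc n))"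
      using K by (intro sum_mono reach_finite_card(2)) auto
    finally have "real (card (B n)) \<le> real (card K * (nbr_bound TYPE('d) ^ Suc n * Suc (Suc n)))"
      by (subst of_nat_le_iff) simp
    then show ?thesis by (simp add: x_def algebra_simps)
  qed

  have occurs_measurable: "Measurable.pred (clocks J) (occurs m t)"
    if "\<And>e. e \<in> K \<Longrightarrow> reach m e \<subseteq> J" for m t J
    unfolding occurs_def
    using that K self_reach
    by (intro pred_random_subset pred_intros_logic clock_le_measurable opens_measurable) blast+
  have occurs_meas [measurable]: "Measurable.pred edge_clocks (occurs m t)" for m t
    using K reach_lattice_edges by (intro occurs_measurable) blast
  have occurs_lim_meas [measurable]: "Measurable.pred edge_clocks (occurs_lim t)" for t
    unfolding occurs_lim_def
    using K by (intro pred_random_subset pred_intros_logic clock_le_measurable opens_limit_measurable) auto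
  have occurs_lim_prob: "cdp_prob k A t = (\<integral>U. of_bool (occurs_lim t U) \<partial>edge_clocks)" for t
  proof -
    have "(\<integral>U. of_bool (occurs_lim t U) \<partial>edge_clocks :: real)
        = (\<integral>U. indicator {U \<in> space edge_clocks. occurs_lim t U} U \<partial>edge_clocks)"
      by (intro Bochner_Integration.integral_cong) (auto simp: indicator_def)
    also have "\<dots> = prob {U \<in> space edge_clocks. occurs_lim t U}"
      by simp
    finally show ?thesis
      using cdp_prob_eq[OF K A, of k t] by (simp add: occurs_lim_def \<A>_def)
  qed
  have integrable: "integrable edge_clocks (\<lambda>U. of_bool (P U) :: real)"
    if [measurable]: "Measurable.pred edge_clocks P" for P :: "('d edge \<Rightarrow> real) \<Rightarrow> bool"
    by (rule integrable_const_bound[where B = 1]) auto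

  have p_le: "p n \<le> card K * (x ^ n / fact n)" for n
  proof -
    have "x ^ n / fact (Suc n) \<le> x ^ n / fact n"
      using x by (intro divide_left_mono fact_mono) auto
    then have "card K * (x ^ n / fact (Suc n)) \<le> card K * (x ^ n / fact n)"
      by (rule mult_left_mono) simp
    then show ?thesis by (simp add: p_def del: fact_Suc)
  qed
  have p_lim: "p \<longlonglongrightarrow> 0"
  proof (rule tendsto_sandwich[OF _ _ tendsto_const])
    show "(\<lambda>n. card K * (x ^ n / fact n)) \<longlonglongrightarrow> 0"
      by (intro tendsto_mult_right_zero summable_LIMSEQ_zero summable_power_over_fact)
  qed (use x p_le in \<open>auto simp: p_def\<close>)

  have F_lim: "(\<lambda>n. F n t) \<longlonglongrightarrow> cdp_prob k A t" for t
  proof -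
    \<comment> \<open>Truncation can only err if some edge of \<open>K\<close> has no final answer
      at depth \<open>n\<close>, hence starts a decreasing path with \<open>n\<close> steps.\<close>
    have "\<bar>F n t - cdp_prob k A t\<bar> \<le> p n" for n
    proof -
      have "F n t - cdp_prob k A t = (\<integral>U. of_bool (occurs n t U) - of_bool (occurs_lim t U) \<partial>edge_clocks)"
        unfolding F_def occurs_lim_prob
        by (intro Bochner_Integration.integral_diff[symmetric] integrable) simp_all
      also have "\<bar>\<dots>\<bar> \<le> (\<integral>U. \<bar>of_bool (occurs n t U) - of_bool (occurs_lim t U)\<bar> \<partial>edge_clocks)"
        by (rule integral_abs_bound)
      also have "\<dots> \<le> p n"
        unfolding p_def x_def
      proof (rule order_trans[OF expectation_differ_le[OF K]])
        fix U assume *: "occurs n t U \<noteq> occurs_lim t U"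
        show "\<exists>e\<in>K. decreasing_path n U e"
        proof (rule ccontr)
          assume "\<not> ?thesis"
          then have "{e \<in> K. U e \<le> t \<and> opens k n U e} = {e \<in> K. U e \<le> t \<and> opens_limit k U e}"
            using opens_limit_eq(1) by blast
          with * show False by (simp add: occurs_def occurs_lim_def)
        qed
      qed simp_all
      finally show ?thesis .
    qed
    then have "(\<lambda>n. F n t - cdp_prob k A t) \<longlonglongrightarrow> 0"
      by (intro Lim_null_comparison[OF _ p_lim]) auto
    then show ?thesis by (rule LIM_zero_cancel)
  qed

  have F_diff: "F (Suc n) t - F n t = (\<integral>U. G n t U \<partial>edge_clocks)" for n t
    unfolding F_def G_def
    by (intro Bochner_Integration.integral_diff[symmetric] integrable) simp_all
  have G_le: "(\<integral>U. \<bar>G n t U\<bar> \<partial>edge_clocks) \<le> p n" for n t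
    unfolding p_def x_def G_def
  proof (rule order_trans[OF expectation_differ_le[OF K]])
    fix U assume *: "occurs (Suc n) t U \<noteq> occurs n t U"
    show "\<exists>e\<in>K. decreasing_path n U e"
    proof (rule ccontr)
      assume "\<not> ?thesis"
      then have "{e \<in> K. U e \<le> t \<and> opens k (Suc n) U e} = {e \<in> K. U e \<le> t \<and> opens k n U e}"
        using decreasing_path_if_opens_differs[of k n U _ 1] by (auto simp del: opens.simps)
      with * show False by (simp add: occurs_def del: opens.simps)
    qed
  qed simp_all

  have ex: "\<exists>D. ((\<lambda>s. \<integral>U. G n s U \<partial>edge_clocks) has_field_derivative D) (at t) \<and>
      \<bar>D\<bar> \<le> card (B n) / min t (1 - t) * (\<integral>U. \<bar>G n t U\<bar> \<partial>edge_clocks)"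
    if t: "0 < t" "t < 1" for n t
  proof (rule expectation_has_bounded_derivative[OF t B, of n "G n"])
    show "G n t \<in> borel_measurable (clocks J)" if "B n \<subseteq> J" for t J
    proof -
      have [measurable]: "Measurable.pred (clocks J) (occurs (Suc n) t)" "Measurable.pred (clocks J) (occurs n t)"
        using reach_B that by (intro occurs_measurable; blast)+
      show ?thesis unfolding G_def by measurable
    qed
    show "\<bar>G n t U\<bar> \<le> 1" for t U by (simp add: G_def)
    show "G n t U = G n t V" if UV: "\<And>e. e \<in> B n \<Longrightarrow> U e = V e" for t U V
    proof -
      have "U e = V e" "opens k n U e = opens k n V e" "opens k (Suc n) U e = opens k (Suc n) V e"
        if "e \<in> K" for e
        using that K reach_B[OF that, of n] self_reach[of e n]
        by (auto intro!: UV opens_local simp del: opens.simps)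
      then have "{e \<in> K. U e \<le> t \<and> opens k n U e} = {e \<in> K. V e \<le> t \<and> opens k n V e}"
          "{e \<in> K. U e \<le> t \<and> opens k (Suc n) U e} = {e \<in> K. V e \<le> t \<and> opens k (Suc n) V e}"
        by (metis (no_types, lifting))+
      then have "occurs n t U = occurs n t V" "occurs (Suc n) t U = occurs (Suc n) t V"
        unfolding occurs_def by (simp_all only:)
      then show ?thesis by (simp add: G_def)
    qed
    show "G n (\<phi> t) (\<lambda>e. \<phi> (U e)) = G n t U" if "strict_mono \<phi>" for t U \<phi>
      by (simp only: G_def occurs_def opens_strict_mono[OF that] strict_mono_less_eq[OF that])
  qed blast
  \<comment> \<open>\<open>deriv\<close> selects the derivatives as functions of \<open>t\<close>;
    by uniqueness of derivatives they inherit the bound from \<open>ex\<close>.\<close>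
  define f' where "f' n t = deriv (\<lambda>s. \<integral>U. G n s U \<partial>edge_clocks) t" for n t
  have f': "((\<lambda>s. \<integral>U. G n s U \<partial>edge_clocks) has_field_derivative f' n t) (at t)"
      "\<bar>f' n t\<bar> \<le> card (B n) / min t (1 - t) * (\<integral>U. \<bar>G n t U\<bar> \<partial>edge_clocks)"
    if "0 < t" "t < 1" for n t
    using ex[OF that, of n] unfolding f'_def by (auto dest: DERIV_imp_deriv)
  \<comment> \<open>The number of clocks and \<open>p n\<close> each contribute a power of
    \<open>x\<close>, which makes \<open>x\<^sup>2\<close> the base. The 2 bounds the quotient
    \<open>(n + 2) / (n + 1)\<close> left over from the factorial, and the factorial still
    wins.\<close>
  define M where "M n = 2 * card K * card K * x * ((x\<^sup>2) ^ n / fact n)" for n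
  have f'_le: "\<bar>f' n t\<bar> \<le> M n / \<delta>" if \<delta>: "0 < \<delta>" "\<delta> \<le> min t (1 - t)" for n t \<delta>
  proof -
    have "\<bar>f' n t\<bar> \<le> card (B n) / min t (1 - t) * (\<integral>U. \<bar>G n t U\<bar> \<partial>edge_clocks)"
      using \<delta> by (intro f') auto
    also have "\<dots> \<le> (card K * x ^ Suc n * (n + 2)) / \<delta> * p n"
      using \<delta> card_B[of n] G_le[of n t] x by (intro mult_mono frac_le) (auto simp: add.commute)
    also have "\<dots> = card K * card K * x * (x\<^sup>2) ^ n / fact n * ((n + 2) / (n + 1)) / \<delta>"
    proof -
      have "(x\<^sup>2) ^ n = x ^ n * x ^ n" by (simp add: power2_eq_square power_mult_distrib)
      moreover have "fact (Suc n) = (n + 1) * (fact n :: real)" by simp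
      ultimately show ?thesis
        by (simp add: p_def mult_ac del: fact_Suc)
    qed
    also have "\<dots> \<le> card K * card K * x * (x\<^sup>2) ^ n / fact n * 2 / \<delta>"
      using x \<delta> by (intro divide_right_mono mult_left_mono) (auto simp: field_simps)
    finally show ?thesis by (simp add: M_def mult_ac)
  qed
  have M: "summable (\<lambda>n. M n / \<delta>)" for \<delta>
    unfolding M_def by (intro summable_divide summable_mult summable_power_over_fact)

  \<comment> \<open>At depth 0 no edge opens, so \<open>F 0\<close> is constant in time and may be
    evaluated at 0.\<close>
  have sums: "(\<lambda>n. \<integral>U. G n t U \<partial>edge_clocks) sums (cdp_prob k A t - F 0 0)" for t
    using telescope_sums[OF F_lim[of t]] by (simp add: F_diff) (simp add: F_def occurs_def)
  have "(\<lambda>t. cdp_prob k A t) differentiable (at t)" if t: "0 < t" "t < 1" for t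
  proof -
    \<comment> \<open>Half the distance from \<open>t\<close> to the endpoints: every point within
      \<open>\<delta>\<close> of \<open>t\<close> still has distance at least
      \<open>\<delta>\<close> from 0 and 1, so one summable bound serves the whole
      neighbourhood.\<close>
    define \<delta> where "\<delta> = min t (1 - t) / 2"
    have \<delta>: "0 < \<delta>" "2 * \<delta> \<le> t" "2 * \<delta> \<le> 1 - t" using t by (auto simp: \<delta>_def)
    have S: "\<delta> \<le> min s (1 - s)" if "s \<in> {t - \<delta><..<t + \<delta>}" for s
      using \<delta> that by auto
    have "(\<lambda>t. \<Sum>n. \<integral>U. G n t U \<partial>edge_clocks) differentiable (at t)"
    proof (rule differentiable_series'[where S = "{t - \<delta><..<t + \<delta>}" and f' = f'])
      show "((\<lambda>s. \<integral>U. G n s U \<partial>edge_clocks) has_field_derivative f' n s) (at s)"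
        if "s \<in> {t - \<delta><..<t + \<delta>}" for n s
        using S[OF that] \<delta> by (intro f') auto
      show "uniformly_convergent_on {t - \<delta><..<t + \<delta>} (\<lambda>n s. \<Sum>i<n. f' i s)"
        using f'_le[OF \<delta>(1) S] M[of \<delta>] by (intro Weierstrass_m_test'[where M = "\<lambda>n. M n / \<delta>"]) auto
    qed (use \<delta> sums in \<open>auto simp: sums_iff\<close>)
    moreover have "cdp_prob k A t = F 0 0 + (\<Sum>n. \<integral>U. G n t U \<partial>edge_clocks)" for t
      using sums_unique[OF sums, of t] by simp
    ultimately show ?thesis by simp
  qed
  then show ?thesis
    by (auto simp: differentiable_on_def intro: differentiable_at_withinI)
qed

end
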